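(* Let $(R,\mathfrak{m})$ be a finite local ring of characteristic $p^N$ with residue field $\mathbb{F}_q$, $q=p^n$, $n>1$, and let $\rho=\dim_{\mathbb{F}_q}\big(\mathfrak{m}/(\mathfrak{m}^2+pR)\big)$. Every maximal subring $S$ of $R$ is of exactly one of two kinds: (i) $S$ has residue field $\mathbb{F}_q$; there are exactly $\dfrac{q^\rho-1}{q-1}$ such maximal subrings (zero exactly when $R$ is isomorphic to the Galois ring $R(N,n)$), and each has index $q$ in $R$; (ii) $S$ has residue field a maximal proper subfield $\mathbb{F}$ of $\mathbb{F}_q$; for each maximal subfield $\mathbb{F}$ there is exactly one such maximal subring, namely $\pi^{-1}(\mathbb{F})$ where $\pi:R\to R/\mathfrak{m}=\mathbb{F}_q$ is the projection, and its index is $[R:\pi^{-1}(\mathbb{F})]=[\mathbb{F}_q:\mathbb{F}]$ (the order of the quotient group $\mathbb{F}_q/\mathbb{F}$). The number of maximal subrings of the second kind equals the number of distinct prime divisors of $n$.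
   Context: All rings are commutative and unital; subrings share the unit. A subring $S$ of a finite local ring $(R,\mathfrak{m})$ is local with $\mathfrak{m}_S=\mathfrak{m}\cap S$, and its residue field is naturally a subfield of $R/\mathfrak{m}$. Indices are indices of additive groups. The Galois ring $R(N,n)$ is $(\mathbb{Z}/p^N\mathbb{Z})[x]/(f)$ for a monic $f$ of degree $n$ irreducible modulo $p$. *)

theory Defs
  imports "HOL-Algebra.Algebra" "HOL-Number_Theory.Residues"
begin

definition ring_char :: "('a, 'b) ring_scheme \<Rightarrow> nat" where
  "ring_char R = (if \<exists>k::nat. 0 < k \<and> [k] \<cdot>\<^bsub>R\<^esub> \<one>\<^bsub>R\<^esub> = \<zero>\<^bsub>R\<^esub>
                  then (LEAST k::nat. 0 < k \<and> [k] \<cdot>\<^bsub>R\<^esub> \<one>\<^bsub>R\<^esub> = \<zero>\<^bsub>R\<^esub>) else 0)"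

definition max_subring :: "('a, 'b) ring_scheme \<Rightarrow> 'a set \<Rightarrow> bool" where
  "max_subring R S \<longleftrightarrow> subring S R \<and> S \<noteq> carrier R \<and>
     (\<forall>T. subring T R \<and> S \<subseteq> T \<and> T \<noteq> carrier R \<longrightarrow> T = S)"

definition max_subfield :: "('a, 'b) ring_scheme \<Rightarrow> 'a set \<Rightarrow> bool" where
  "max_subfield K F \<longleftrightarrow> subfield F K \<and> F \<noteq> carrier K \<and>
     (\<forall>E. subfield E K \<and> F \<subseteq> E \<and> E \<noteq> carrier K \<longrightarrow> E = F)"

definition proj :: "('a, 'b) ring_scheme \<Rightarrow> 'a set \<Rightarrow> 'a \<Rightarrow> 'a set" where
  "proj R m x = m +>\<^bsub>R\<^esub> x"

(* Residue field of a subring S of the local ring (R,m), viewed as the subfield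
   (S + m)/m = pi(S) of R/m (the natural embedding of S/(m \<inter> S) into R/m). *)
definition res_field :: "('a, 'b) ring_scheme \<Rightarrow> 'a set \<Rightarrow> 'a set \<Rightarrow> 'a set set" where
  "res_field R m S = proj R m ` S"

definition add_index :: "('a, 'b) ring_scheme \<Rightarrow> 'a set \<Rightarrow> nat" where
  "add_index R H = card (a_rcosets\<^bsub>R\<^esub> H)"

definition galois_ring :: "nat \<Rightarrow> nat \<Rightarrow> int list \<Rightarrow> int list set ring" where
  "galois_ring p N f =
     (let A = residue_ring (int (p ^ N)) in poly_ring A Quot (PIdl\<^bsub>poly_ring A\<^esub> f))"

definition galois_modulus :: "nat \<Rightarrow> nat \<Rightarrow> nat \<Rightarrow> int list \<Rightarrow> bool" where
  "galois_modulus p N n f \<longleftrightarrow>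
     (let A = residue_ring (int (p ^ N)); B = residue_ring (int p) in
       polynomial\<^bsub>A\<^esub> (carrier A) f \<and> lead_coeff f = 1 \<and> degree f = n \<and>
       pirreducible\<^bsub>B\<^esub> (carrier B) (map (\<lambda>c. c mod int p) f))"

(* R is isomorphic to the Galois ring R(N,n) (for some, equivalently any, valid modulus). *)
definition iso_galois_ring :: "('a, 'b) ring_scheme \<Rightarrow> nat \<Rightarrow> nat \<Rightarrow> nat \<Rightarrow> bool" where
  "iso_galois_ring R p N n \<longleftrightarrow> (\<exists>f. galois_modulus p N n f \<and> R \<simeq> galois_ring p N f)"

end

(*
Write k = R/m, J = m^2 + pR and, for a subring S, consider its image S' in the finite field k.

If S' is not k, maximality forces S to be the full preimage of S', and S' to be a maximal subfield;
these correspond to the prime divisors of n.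

If S' = k, take an ideal I minimal with S + I = R and an ideal K just below I. By maximality K lies
in S, and by Nakayama m I lies in K; writing elements of m and R as sums from S and I gives J <= S.
Modulo J the ring has characteristic p and m has square zero, so x |-> x^q is additive and kills m.
Hence for every ideal I between J and m the set {x. x^q - x in I} is the unique subring containing J
that maps onto k and meets m in I, and the maximal subrings sought are the hyperplanes of the
k-space m/J.  These are counted by induction on the dimension: pairs (vector, hyperplane
through it) are counted in two ways.

Finally m = J iff m = pR iff |R| <= q^N, by comparing successive quotients of the chain p^i R. A Galois
ring has at most p^(N n) elements by division with remainder; conversely, if m = pR, a lift a of a
generator of k* has powers 1, a, ..., a^(n-1) spanning R over Z/p^N, so a satisfies a monic relation
of degree n, irreducible modulo p, and evaluation at a gives the isomorphism.
*)
theory Submission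
  imports Defs
begin

section \<open>Cosets and ideals\<close>

text \<open>Dimensions are replaced by sizes throughout: \<rho> enters through card (m/J) =
  q^\<rho>, a hyperplane of m/J is an ideal maximal below m among those containing J, and indices
  are read off from Lagrange counts. Two isomorphisms carry all counting: R/(I : v) with (I + Rv)/I,
  and W/(H \<inter> W) with (H + W)/H.

  The minimal choice of I with S + I = R is what makes m I \<subseteq> S provable: for K just below
  I the subring S + K is still proper, since S + K = R would contradict minimality.

  Because J contains m^2 and q \<ge> 2, the q-th power map modulo J depends only on the class modulo
  m. A single q-th power x^q is therefore already the Teichmueller representative of x modulo J, and
  no Hensel-style iteration occurs.

  In the Galois part the obstacle is that Z/p^N is not a domain once N > 1. Polynomials over it are
  treated as integer polynomials with coefficients in 0..p^N - 1: ring laws, division by a monic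
  polynomial and evaluation are settled in Z[x] and pushed down by reduction.\<close>

lemma card_image_cong_fibres:
  assumes "\<And>x y. x \<in> A \<Longrightarrow> y \<in> A \<Longrightarrow> f x = f y \<longleftrightarrow> g x = g y"
  shows "card (f ` A) = card (g ` A)"
proof -
  have "bij_betw (\<lambda>z. g (inv_into A f z)) (f ` A) (g ` A)"
  proof (rule bij_betw_imageI)
    have *: "g (inv_into A f (f x)) = g x" if "x \<in> A" for x
      using that assms f_inv_into_f[of "f x" f A] inv_into_into[of "f x" f A] by simp
    then show "inj_on (\<lambda>z. g (inv_into A f z)) (f ` A)" 
      using assms by (auto intro!: inj_onI)
    show "(\<lambda>z. g (inv_into A f z)) ` f ` A = g ` A"
      using * by (force simp: image_iff)
  qed
  then show ?thesis by (rule bij_betw_same_card)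
qed

text \<open>The second isomorphism theorem as a count: W splits into the fibres of the projection
  modulo H, and each fibre is a translate of H \<inter> W. H need not lie in W, so the lemma applies
  to ideals, to subrings and to the whole ring alike.\<close>

lemma (in abelian_group) card_image_cosets_restrict:
  assumes "additive_subgroup H G" "additive_subgroup W G" "finite (carrier G)"
  shows "card ((+>) H ` W) * card (H \<inter> W) = card W"
proof -
  interpret H: abelian_subgroup H G
    using assms(1) abelian_subgroupI3 abelian_group_axioms by blast
  interpret W: additive_subgroup W G by fact
  have fin: "finite W" using assms(3) W.a_subset finite_subset by blast
  have eq: "H +> x = H +> y \<longleftrightarrow> x \<ominus> y \<in> H" if "x \<in> carrier G" "y \<in> carrier G" for x y
    using that H.a_rcos_module[of y x] H.a_rcos_self[of x] H.a_subgroup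
      a_repr_independence[of x H y] by (auto simp: a_minus_def)
  have "card {y \<in> W. H +> y = C} = card (H \<inter> W)" if "C \<in> (+>) H ` W" for C
  proof -
    from that obtain x where x: "x \<in> W" "C = H +> x" by auto
    have "bij_betw (\<lambda>h. h \<oplus> x) (H \<inter> W) {y \<in> W. H +> y = C}"
    proof (rule bij_betwI[where g = "\<lambda>y. y \<ominus> x"])
      show "(\<lambda>h. h \<oplus> x) \<in> H \<inter> W \<rightarrow> {y \<in> W. H +> y = C}"
      proof
        fix h assume h: "h \<in> H \<inter> W"
        then have "h \<oplus> x \<in> carrier G" "x \<in> carrier G" "h \<in> carrier G" using x by auto
        then show "h \<oplus> x \<in> {y \<in> W. H +> y = C}"
          using h x eq[of "h \<oplus> x" x] by (auto simp: a_minus_def a_assoc r_neg)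
      qed
      show "(\<lambda>y. y \<ominus> x) \<in> {y \<in> W. H +> y = C} \<rightarrow> H \<inter> W"
        using x eq by (auto simp: a_minus_def)
    qed (use x in \<open>auto simp: a_minus_def a_assoc r_neg l_neg\<close>)
    then show ?thesis using bij_betw_same_card by metis
  qed
  then have "card W = (\<Sum>C\<in>(+>) H ` W. card (H \<inter> W))"
    using sum.image_gen[of W "\<lambda>_. 1::nat" "(+>) H", OF fin] by simp
  then show ?thesis by simp
qed

lemma (in ring) additive_subgroup_ideal: "ideal I R \<Longrightarrow> additive_subgroup I R"
  by (rule ideal.axioms(1))

lemma (in ring) additive_subgroup_subring: "subring S R \<Longrightarrow> additive_subgroup S R"
  by (simp add: additive_subgroup_def subring.axioms(1))

text \<open>This is the colon ideal (I : v), the annihilator of the class of v modulo I.\<close>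

lemma (in cring) ideal_colon:
  assumes "ideal I R" "v \<in> carrier R"
  shows "ideal {r \<in> carrier R. r \<otimes> v \<in> I} R"
proof -
  interpret I: ideal I R by fact
  show ?thesis
  proof (rule idealI)
    show "subgroup {r \<in> carrier R. r \<otimes> v \<in> I} (add_monoid R)"
      by (rule add.subgroupI) (use assms in \<open>auto simp: l_distr l_minus intro!: exI[of _ \<zero>]\<close>)
    fix a x assume "a \<in> {r \<in> carrier R. r \<otimes> v \<in> I}" "x \<in> carrier R"
    then have *: "a \<in> carrier R" "a \<otimes> v \<in> I" "x \<in> carrier R" by auto
    then have "x \<otimes> (a \<otimes> v) \<in> I" by (simp add: I.I_l_closed)
    then show "x \<otimes> a \<in> {r \<in> carrier R. r \<otimes> v \<in> I}" "a \<otimes> x \<in> {r \<in> carrier R. r \<otimes> v \<in> I}"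
      using * assms(2) m_comm[of a x] by (auto simp: m_assoc)
  qed (rule ring_axioms)
qed

definition (in cring) adjoin :: "'a set \<Rightarrow> 'a \<Rightarrow> 'a set"
  where "adjoin I v = {i \<oplus> r \<otimes> v | i r. i \<in> I \<and> r \<in> carrier R}"

lemma (in cring) mem_adjoin:
  "x \<in> adjoin I v \<longleftrightarrow> (\<exists>i\<in>I. \<exists>r\<in>carrier R. x = i \<oplus> r \<otimes> v)"
  unfolding adjoin_def by blast

lemma (in cring) ideal_adjoin:
  assumes "ideal I R" "v \<in> carrier R"
  shows "ideal (adjoin I v) R"
proof -
  have "adjoin I v = set_add R I (PIdl v)"
    unfolding adjoin_def set_add_def' cgenideal_def by blast
  then show ?thesis using assms add_ideals cgenideal_ideal by metis
qed

lemma (in cring) subset_adjoin: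
  assumes "ideal I R" "v \<in> carrier R"
  shows "I \<subseteq> adjoin I v" "v \<in> adjoin I v"
proof -
  interpret I: ideal I R by fact
  show "I \<subseteq> adjoin I v"
  proof
    fix x assume x: "x \<in> I"
    then have "x = x \<oplus> \<zero> \<otimes> v" using assms(2) by simp
    then show "x \<in> adjoin I v" using x unfolding mem_adjoin by blast
  qed
  have "v = \<zero> \<oplus> \<one> \<otimes> v" using assms(2) by simp
  then show "v \<in> adjoin I v"
    using I.zero_closed unfolding mem_adjoin by blast
qed

lemma (in cring) adjoin_minimal:
  assumes "ideal J R" "I \<subseteq> J" "v \<in> J"
  shows "adjoin I v \<subseteq> J"
proof -
  interpret J: ideal J R by fact
  show ?thesis using assms by (auto simp: mem_adjoin subset_iff J.I_l_closed)
qed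

text \<open>The map r \<mapsto> r v + I from R onto (I + Rv)/I has kernel (I : v), so both quotients
  have the same number of cosets. The identity is kept in product form to avoid division.\<close>

lemma (in cring) card_adjoin:
  assumes "ideal I R" "v \<in> carrier R" "finite (carrier R)"
  shows "card (adjoin I v) * card {r \<in> carrier R. r \<otimes> v \<in> I} = card (carrier R) * card I"
proof -
  interpret I: ideal I R by fact
  let ?C = "{r \<in> carrier R. r \<otimes> v \<in> I}" and ?J = "adjoin I v"
  have J: "ideal ?J R" using assms ideal_adjoin by blast
  have C: "ideal ?C R" using ideal_colon assms by blast
  have "(+>) I ` ?J = (\<lambda>r. I +> (r \<otimes> v)) ` carrier R"
  proof (intro subset_antisym subsetI)
    fix Y assume "Y \<in> (+>) I ` ?J"
    then obtain i r where "i \<in> I" "r \<in> carrier R" "Y = I +> (i \<oplus> r \<otimes> v)"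
      using mem_adjoin by auto
    moreover have "I +> (i \<oplus> r \<otimes> v) = I +> (r \<otimes> v)" if "i \<in> I" "r \<in> carrier R" for i r
      using that assms quotient_eq_iff_same_a_r_cos[OF assms(1), of "i \<oplus> r \<otimes> v" "r \<otimes> v"] I.a_subset
      by (auto simp: a_minus_def a_assoc r_neg subset_iff)
    ultimately show "Y \<in> (\<lambda>r. I +> (r \<otimes> v)) ` carrier R" by auto
  next
    fix Y assume "Y \<in> (\<lambda>r. I +> (r \<otimes> v)) ` carrier R"
    then obtain r where r: "r \<in> carrier R" "Y = I +> (r \<otimes> v)" by auto
    have "\<zero> \<oplus> r \<otimes> v \<in> ?J" using r I.zero_closed unfolding mem_adjoin by blast
    then have "r \<otimes> v \<in> ?J" using r assms by simp
    then show "Y \<in> (+>) I ` ?J" using r by auto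
  qed
  moreover have "card ((\<lambda>r. I +> (r \<otimes> v)) ` carrier R) = card ((+>) ?C ` carrier R)"
  proof -
    have *: "I +> (r \<otimes> v) = I +> (s \<otimes> v) \<longleftrightarrow> ?C +> r = ?C +> s" if "r \<in> carrier R" "s \<in> carrier R" for r s
      using that assms(2) quotient_eq_iff_same_a_r_cos[OF assms(1), of "r \<otimes> v" "s \<otimes> v"]
        quotient_eq_iff_same_a_r_cos[OF C, of r s]
      by (simp add: a_minus_def l_distr l_minus)
    then show ?thesis by (intro card_image_cong_fibres) auto
  qed
  ultimately have c: "card ((+>) I ` ?J) = card ((+>) ?C ` carrier R)" by simp
  have J': "card ?J = card ((+>) I ` ?J) * card I"
  proof -
    have "I \<inter> ?J = I" using subset_adjoin assms by blast
    then show ?thesis using card_image_cosets_restrict[of I ?J] J assms additive_subgroup_ideal by simp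
  qed
  have C': "card (carrier R) = card ((+>) ?C ` carrier R) * card ?C"
  proof -
    have "?C \<inter> carrier R = ?C" by blast
    then show ?thesis using card_image_cosets_restrict[of ?C "carrier R"] C oneideal assms(3) additive_subgroup_ideal by simp
  qed
  show ?thesis
    unfolding J' C' c by (simp only: ac_simps)
qed

text \<open>J is only a lower bound; maximality is tested against all ideals properly inside I. With
  I = m and m m \<subseteq> J these are the hyperplanes of the vector space m/J; with J = {\<zero>}
  they are all the ideals just below I.\<close>

definition (in ring) maximal_subideals :: "'a set \<Rightarrow> 'a set \<Rightarrow> 'a set set"
  where "maximal_subideals J I = {K. ideal K R \<and> J \<subseteq> K \<and> K \<subset> I \<and>
    (\<forall>L. ideal L R \<and> K \<subseteq> L \<and> L \<subset> I \<longrightarrow> L = K)}"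

lemma (in ring) maximal_subideals_nonempty:
  assumes "ideal J R" "J \<subset> I" "finite I"
  obtains K where "K \<in> maximal_subideals J I"
proof -
  let ?A = "{K. ideal K R \<and> J \<subseteq> K \<and> K \<subset> I}"
  have "finite ?A" by (rule finite_subset[of _ "Pow I"]) (use assms in auto)
  moreover have "J \<in> ?A" using assms by auto
  ultimately have "\<exists>K\<in>?A. J \<subseteq> K \<and> (\<forall>L\<in>?A. K \<subseteq> L \<longrightarrow> K = L)"
    by (rule finite_has_maximal2)
  then obtain K where K: "K \<in> ?A" "\<forall>L\<in>?A. K \<subseteq> L \<longrightarrow> K = L"
    by (elim bexE conjE)
  then have "K \<in> maximal_subideals J I"
    unfolding maximal_subideals_def by auto
  then show ?thesis by (rule that)
qed

section \<open>Sizes of ideals in a finite local ring\<close>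

locale finite_local_ring = cring R for R (structure) +
  fixes m
  assumes finite_carrier: "finite (carrier R)"
    and maximal: "maximalideal m R"
    and maximal_unique: "maximalideal I R \<Longrightarrow> I = m"
begin

abbreviation q :: nat where "q \<equiv> card (carrier (R Quot m))"

sublocale m: maximalideal m R by (rule maximal)

lemma finite_m: "finite m" using finite_carrier m.a_subset finite_subset by blast

lemma finite_ideal: "ideal I R \<Longrightarrow> finite I"
  using finite_carrier ideal.axioms(1) additive_subgroup.a_subset finite_subset by metis

lemma card_ideal_pos: "ideal I R \<Longrightarrow> card I > 0"
  using finite_ideal additive_subgroup.zero_closed[OF ideal.axioms(1)] card_gt_0_iff by blast

lemma card_m_nonzero: "card m \<noteq> 0"
  using card_ideal_pos[OF m.ideal_axioms] by linarith

lemma proper_ideal_subset: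
  assumes "ideal I R" "I \<noteq> carrier R"
  shows "I \<subseteq> m"
proof -
  interpret I: ideal I R by fact
  obtain K where K: "K \<in> maximal_subideals I (carrier R)"
    using maximal_subideals_nonempty[OF assms(1), of "carrier R"] assms(2) I.a_subset finite_carrier by blast
  then have "maximalideal K R"
    unfolding maximal_subideals_def
    by (intro maximalidealI) (auto simp: psubset_eq)
  then show ?thesis using maximal_unique K unfolding maximal_subideals_def by blast
qed

lemma card_carrier: "card (carrier R) = q * card m"
  using a_lagrange[OF finite_carrier, of m] m.additive_subgroup_axioms
  by (simp add: order_def FactRing_def)

lemma one_notin_m: "\<one> \<notin> m"
  using m.I_notcarr m.one_imp_carrier by blast

lemma q_pos: "q > 0"
  using card_carrier card_ideal_pos[OF oneideal] by (cases "q = 0") auto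

text \<open>Since v is not in I, the colon ideal misses \<one>, so it is proper and lies in m. This
  is how locality enters the size estimates.\<close>

lemma colon_subset:
  assumes "ideal I R" "v \<in> carrier R" "v \<notin> I"
  shows "{r \<in> carrier R. r \<otimes> v \<in> I} \<subseteq> m"
proof (rule proper_ideal_subset[OF ideal_colon[OF assms(1,2)]])
  have "\<one> \<notin> {r \<in> carrier R. r \<otimes> v \<in> I}" using assms by auto
  then show "{r \<in> carrier R. r \<otimes> v \<in> I} \<noteq> carrier R" by auto
qed

text \<open>(I + Rv)/I is isomorphic to R/(I : v), and (I : v) \<subseteq> m makes R/m a quotient of
  the latter. Equality holds once m v \<subseteq> I, which is the companion lemma.\<close>

lemma card_adjoin_ge:
  assumes "ideal I R" "v \<in> carrier R" "v \<notin> I"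
  shows "q * card I \<le> card (adjoin I v)"
proof -
  let ?C = "{r \<in> carrier R. r \<otimes> v \<in> I}"
  have "card (adjoin I v) * card ?C = (q * card I) * card m"
    using card_adjoin[OF assms(1,2) finite_carrier] card_carrier by simp
  moreover have "card ?C \<le> card m" using colon_subset[OF assms] finite_m card_mono by blast
  ultimately have "(q * card I) * card m \<le> card (adjoin I v) * card m"
    using mult_le_mono2[of "card ?C" "card m" "card (adjoin I v)"] by linarith
  then show ?thesis using card_m_nonzero mult_le_cancel2 by blast
qed

lemma card_adjoin_eq:
  assumes "ideal I R" "v \<in> carrier R" "v \<notin> I" "\<And>x. x \<in> m \<Longrightarrow> x \<otimes> v \<in> I"
  shows "card (adjoin I v) = q * card I"
proof -
  let ?C = "{r \<in> carrier R. r \<otimes> v \<in> I}"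
  have "?C = m" using colon_subset[OF assms(1-3)] assms(4) m.a_subset by blast
  then have "card (adjoin I v) * card m = (q * card I) * card m"
    using card_adjoin[OF assms(1,2) finite_carrier] card_carrier by (simp only: ac_simps)
  then show ?thesis using card_m_nonzero mult_right_cancel by blast
qed

lemma one_minus_notin_m:
  assumes "x \<in> m" "r \<in> carrier R"
  shows "\<one> \<ominus> r \<otimes> x \<notin> m"
proof
  assume *: "\<one> \<ominus> r \<otimes> x \<in> m"
  have "r \<otimes> x \<in> m" using assms m.I_l_closed by blast
  with * have "(\<one> \<ominus> r \<otimes> x) \<oplus> r \<otimes> x \<in> m" by blast
  then show False using one_notin_m assms m.a_subset 
    by (simp add: a_minus_def a_assoc l_neg subset_iff)
qed

text \<open>Nakayama: an ideal just below \<open>I\<close> contains \<open>m I\<close>, since \<open>1 - r x\<close> is never in \<open>m\<close> for \<open>x \<in> m\<close>.\<close>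
lemma maximal_subideal_mult:
  assumes "ideal I R" "K \<in> maximal_subideals J I" "x \<in> m" "v \<in> I"
  shows "x \<otimes> v \<in> K"
proof (rule ccontr)
  assume neg: "x \<otimes> v \<notin> K"
  interpret I: ideal I R by fact
  interpret K: ideal K R using assms(2) unfolding maximal_subideals_def by auto
  have carr: "x \<in> carrier R" "v \<in> carrier R" using assms m.a_subset I.a_subset by auto
  have xv: "x \<otimes> v \<in> I" "x \<otimes> v \<in> carrier R" using assms carr I.I_l_closed by auto
  let ?L = "adjoin K (x \<otimes> v)"
  have "ideal ?L R" "K \<subseteq> ?L" "?L \<noteq> K" "?L \<subseteq> I"
    using ideal_adjoin[OF K.ideal_axioms xv(2)] subset_adjoin[OF K.ideal_axioms xv(2)] neg
      adjoin_minimal[OF assms(1) _ xv(1), of K] assms(2) unfolding maximal_subideals_def by auto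
  then have "?L = I" using assms(2) unfolding maximal_subideals_def by blast
  then obtain k r where kr: "k \<in> K" "r \<in> carrier R" "v = k \<oplus> r \<otimes> (x \<otimes> v)"
    using assms(4) mem_adjoin by blast
  have "k \<in> carrier R" using kr by simp
  have "(\<one> \<ominus> r \<otimes> x) \<otimes> v = v \<ominus> r \<otimes> (x \<otimes> v)"
    using kr(2) carr by algebra
  also have "\<dots> = (k \<oplus> r \<otimes> (x \<otimes> v)) \<ominus> r \<otimes> (x \<otimes> v)" using kr(3) by simp
  also have "\<dots> = k" using kr(2) carr \<open>k \<in> carrier R\<close> by algebra
  finally have "\<one> \<ominus> r \<otimes> x \<in> {r \<in> carrier R. r \<otimes> v \<in> K}" using kr carr by simp
  moreover have "v \<notin> K" using neg K.I_l_closed carr by blast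
  ultimately have "\<one> \<ominus> r \<otimes> x \<in> m" using colon_subset[OF K.ideal_axioms carr(2)] by blast
  then show False using one_minus_notin_m[OF assms(3) kr(2)] by simp
qed

text \<open>Any v in I outside K satisfies K + Rv = I by maximality, and m v \<subseteq> K by the
  Nakayama argument, so I/K is one-dimensional over R/m.\<close>

lemma card_maximal_subideal:
  assumes "ideal I R" "K \<in> maximal_subideals J I"
  shows "card I = q * card K"
proof -
  interpret I: ideal I R by fact
  interpret K: ideal K R using assms(2) unfolding maximal_subideals_def by auto
  obtain v where v: "v \<in> I" "v \<notin> K" using assms(2) unfolding maximal_subideals_def by auto
  let ?L = "adjoin K v"
  have vc: "v \<in> carrier R" using v by simp
  have "ideal ?L R" "K \<subseteq> ?L" "?L \<noteq> K" "?L \<subseteq> I"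
    using ideal_adjoin[OF K.ideal_axioms vc] subset_adjoin[OF K.ideal_axioms vc] v
      adjoin_minimal[OF assms(1) _ v(1), of K] assms(2) unfolding maximal_subideals_def by auto
  then have "?L = I" using assms(2) unfolding maximal_subideals_def by blast
  then show ?thesis 
    using card_adjoin_eq[OF K.ideal_axioms vc v(2)] maximal_subideal_mult[OF assms _ v(1)] by metis
qed

text \<open>J varies in the induction: for v in m - J the ideal J + Rv still contains all products
  of elements of m, its quotient in m has one dimension less, and the hyperplanes over it are those
  over J that contain v.\<close>

lemma card_maximal_subideals:
  assumes "ideal J R" "J \<subseteq> m" "\<And>x y. x \<in> m \<Longrightarrow> y \<in> m \<Longrightarrow> x \<otimes> y \<in> J"
    and "card m = q ^ r * card J" and "q > 1"
  shows "card (maximal_subideals J m) * (q - 1) = q ^ r - 1"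
  using assms(1-4)
proof (induction r arbitrary: J)
  case 0
  then have "J = m" using finite_m by (simp add: card_subset_eq)
  then have "maximal_subideals J m = {}" unfolding maximal_subideals_def by auto
  then show ?case by simp
next
  case (Suc r)
  note J = Suc.prems
  interpret J: ideal J R by (rule J)
  let ?H = "maximal_subideals J m"
  have finH: "finite ?H" by (rule finite_subset[of _ "Pow m"]) (auto simp: maximal_subideals_def finite_m)
  have cJ: "card J > 0" using card_ideal_pos J by blast
  have fJ: "finite J" using finite_ideal J by blast
  have cardI: "card I = q ^ r * card J" if "I \<in> ?H" for I
  proof -
    have "q * card I = q * (q ^ r * card J)" 
      using card_maximal_subideal[OF m.ideal_axioms that] J(4) by (simp only: power_Suc ac_simps)
    then show ?thesis using q_pos mult_left_cancel by blast
  qed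
  have adj: "ideal (adjoin J v) R" "adjoin J v \<subseteq> m" "card m = q ^ r * card (adjoin J v)"
     "maximal_subideals (adjoin J v) m = {I \<in> ?H. v \<in> I}" "J \<subseteq> adjoin J v"
    if v: "v \<in> m - J" for v
  proof -
    have vc: "v \<in> carrier R" "v \<in> m" "v \<notin> J" using v m.a_subset by auto
    show "ideal (adjoin J v) R" "J \<subseteq> adjoin J v" using ideal_adjoin subset_adjoin J(1) vc by blast+
    show "adjoin J v \<subseteq> m" using adjoin_minimal[OF m.ideal_axioms J(2) vc(2)] .
    show "card m = q ^ r * card (adjoin J v)"
      using card_adjoin_eq[OF J(1) vc(1,3)] J(3,4) vc(2) by simp
    have *: "adjoin J v \<subseteq> K \<longleftrightarrow> J \<subseteq> K \<and> v \<in> K" if "ideal K R" for K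
      using subset_adjoin[OF J(1) vc(1)] adjoin_minimal[OF that, of J v] by blast
    show "maximal_subideals (adjoin J v) m = {I \<in> ?H. v \<in> I}"
      unfolding maximal_subideals_def using * by (auto simp del: subset_iff)
  qed
  show ?case
  \<comment> \<open>In dimension one both double counts carry the factor q^0 - 1 = 0, which cannot
    be cancelled. There J itself is the only hyperplane, and this is shown directly.\<close>
  proof (cases "r = 0")
    case True
    have "?H = {J}"
    proof (intro subset_antisym subsetI)
      fix I assume I: "I \<in> ?H"
      then have "card I = card J" "J \<subseteq> I" using cardI True by (auto simp: maximal_subideals_def)
      moreover have "finite I" using I finite_ideal by (auto simp: maximal_subideals_def)
      ultimately show "I \<in> {J}" using card_subset_eq[of I J] by simp
    next
      have "J \<noteq> m" using J(4) cJ assms(5) True by auto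
      moreover have "L = J" if L: "ideal L R" "J \<subseteq> L" "L \<subset> m" for L
      proof (rule ccontr)
        assume "L \<noteq> J"
        then obtain v where v: "v \<in> L" "v \<notin> J" using L by blast
        then have vm: "v \<in> m - J" using L by blast
        then have "card m = card (adjoin J v)" "adjoin J v \<subseteq> m" using adj(2,3)[OF vm] True by auto
        then have "adjoin J v = m" using card_subset_eq[OF finite_m, of "adjoin J v"] by simp
        then show False using adjoin_minimal[OF L(1,2) v(1)] L by blast
      qed
      ultimately show "I \<in> ?H" if "I \<in> {J}" for I
        using that J unfolding maximal_subideals_def by auto
    qed
    then show ?thesis using True by simp
  next
    case False
    have qr: "q ^ r > 1" using one_less_power[OF assms(5)] False by blast
    \<comment> \<open>Vectors are elements of m rather than classes in m/J, which puts the factor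
      \<open>card J\<close> on both sides. Excluding v in J makes J + Rv strictly larger than J, so
      that the induction hypothesis applies to each v.\<close>
    define P where "P = {(v, I). v \<in> m - J \<and> I \<in> ?H \<and> v \<in> I}"
    have "P = (SIGMA v:m - J. maximal_subideals (adjoin J v) m)"
      unfolding P_def by (auto simp: adj(4))
    then have "card P = (\<Sum>v\<in>m - J. card (maximal_subideals (adjoin J v) m))"
      using finite_m finH by (simp add: adj(4))
    then have "card P * (q - 1) = (\<Sum>v\<in>m - J. card (maximal_subideals (adjoin J v) m) * (q - 1))"
      by (simp add: sum_distrib_right)
    also have "\<dots> = (\<Sum>v\<in>m - J. q ^ r - 1)"
    proof (rule sum.cong[OF refl])
      fix v assume v: "v \<in> m - J"
      show "card (maximal_subideals (adjoin J v) m) * (q - 1) = q ^ r - 1"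
        by (rule Suc.IH) (use adj[OF v] J in auto)
    qed
    also have "\<dots> = ((q ^ Suc r - 1) * card J) * (q ^ r - 1)"
      using card_Diff_subset[OF fJ J(2)] J(4) by (simp add: diff_mult_distrib)
    finally have 1: "card P * (q - 1) = ((q ^ Suc r - 1) * card J) * (q ^ r - 1)" .
    have "P = (\<lambda>(I, v). (v, I)) ` (SIGMA I:?H. I - J)"
      unfolding P_def maximal_subideals_def by force
    then have "card P = card (SIGMA I:?H. I - J)"
      by (simp add: card_image inj_on_def split: prod.splits)
    also have "\<dots> = (\<Sum>I\<in>?H. card (I - J))"
      using finH finite_ideal by (simp add: maximal_subideals_def)
    also have "\<dots> = (\<Sum>I\<in>?H. (q ^ r - 1) * card J)"
    proof (rule sum.cong[OF refl])
      fix I assume I: "I \<in> ?H"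
      then have "J \<subseteq> I" by (auto simp: maximal_subideals_def)
      then show "card (I - J) = (q ^ r - 1) * card J"
        using card_Diff_subset[OF fJ] cardI[OF I] by (simp add: diff_mult_distrib)
    qed
    finally have "card P = card ?H * ((q ^ r - 1) * card J)" by simp
    with 1 have "(card ?H * (q - 1)) * ((q ^ r - 1) * card J) = (q ^ Suc r - 1) * ((q ^ r - 1) * card J)"
      by (simp add: ac_simps)
    then show ?thesis using qr cJ by simp
  qed
qed

end

section \<open>Frobenius and finite fields\<close>

lemma (in cring) binomial_sum:
  fixes n :: nat
  assumes "x \<in> carrier R" "y \<in> carrier R"
  shows "(x \<oplus> y) [^] n = (\<Oplus>k\<in>{..n}. add_pow R (n choose k) (x [^] k \<otimes> y [^] (n - k)))"
proof (induction n)
  case 0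
  then show ?case using assms by simp
next
  case (Suc n)
  define a where "a k = add_pow R (n choose k) (x [^] Suc k \<otimes> y [^] (n - k))" for k
  define b where "b k = add_pow R (n choose k) (x [^] k \<otimes> y [^] (Suc n - k))" for k
  define t where "t k = add_pow R (n choose k) (x [^] k \<otimes> y [^] (n - k))" for k
  have [simp]: "a k \<in> carrier R" "b k \<in> carrier R" "t k \<in> carrier R" for k
    unfolding a_def b_def t_def using assms by auto
  have xt: "t k \<otimes> x = a k" for k
  proof -
    have "(x [^] k \<otimes> y [^] (n - k)) \<otimes> x = x [^] Suc k \<otimes> y [^] (n - k)"
      using assms by (simp add: m_comm m_lcomm m_assoc)
    then show ?thesis unfolding a_def t_def using assms by (simp add: add_pow_ldistr)
  qed
  have yt: "t k \<otimes> y = b k" if "k \<le> n" for k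
  proof -
    have "(x [^] k \<otimes> y [^] (n - k)) \<otimes> y = x [^] k \<otimes> y [^] (Suc n - k)"
      using assms that by (simp add: m_assoc Suc_diff_le)
    then show ?thesis unfolding b_def t_def using assms by (simp add: add_pow_ldistr)
  qed
  have step: "a k \<oplus> b (Suc k) = add_pow R (Suc n choose Suc k) (x [^] Suc k \<otimes> y [^] (Suc n - Suc k))" for k
    unfolding a_def b_def using assms by (simp add: add.nat_pow_mult)
  have "(x \<oplus> y) [^] Suc n = (\<Oplus>k\<in>{..n}. t k) \<otimes> (x \<oplus> y)"
    using Suc.IH by (simp add: t_def)
  also have "\<dots> = (\<Oplus>k\<in>{..n}. t k \<otimes> x) \<oplus> (\<Oplus>k\<in>{..n}. t k \<otimes> y)"
    using assms by (simp add: r_distr finsum_ldistr)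
  also have "(\<Oplus>k\<in>{..n}. t k \<otimes> x) = (\<Oplus>k\<in>{..n}. a k)"
    by (simp only: xt)
  also have "(\<Oplus>k\<in>{..n}. t k \<otimes> y) = (\<Oplus>k\<in>{..n}. b k)"
    by (rule finsum_cong') (auto simp: yt)
  \<comment> \<open>The added term has the coefficient n choose (n + 1) = 0. With it, splitting off
    k = 0 aligns this sum with the first one for Pascal's rule.\<close>
  also have "\<dots> = (\<Oplus>k\<in>{..Suc n}. b k)"
  proof -
    have "b (Suc n) = \<zero>" unfolding b_def using assms by (simp add: binomial_eq_0)
    then show ?thesis by simp
  qed
  also have "\<dots> = (\<Oplus>k\<in>{..n}. b (Suc k)) \<oplus> b 0"
    by (rule finsum_Suc2) auto
  also have "(\<Oplus>k\<in>{..n}. a k) \<oplus> ((\<Oplus>k\<in>{..n}. b (Suc k)) \<oplus> b 0) = (\<Oplus>k\<in>{..n}. a k \<oplus> b (Suc k)) \<oplus> b 0"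
    by (simp add: finsum_addf a_assoc)
  also have "\<dots> = (\<Oplus>k\<in>{..Suc n}. add_pow R (Suc n choose k) (x [^] k \<otimes> y [^] (Suc n - k)))"
    unfolding step using assms by (subst finsum_Suc2) (auto simp: b_def)
  finally show ?case .
qed

lemma (in cring) frobenius_add:
  fixes p :: nat
  assumes "Factorial_Ring.prime p" "add_pow R p \<one> = \<zero>" "x \<in> carrier R" "y \<in> carrier R"
  shows "(x \<oplus> y) [^] p = x [^] p \<oplus> y [^] p"
proof -
  define f where "f k = add_pow R (p choose k) (x [^] k \<otimes> y [^] (p - k))" for k
  have f [simp]: "f k \<in> carrier R" for k unfolding f_def using assms by auto
  have p: "p > 1" using assms(1) prime_gt_1_nat by blast
  have "f k = \<zero>" if "k \<in> {0<..<p}" for k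
  proof -
    have "p dvd (p choose k)" using that assms(1) by (intro dvd_choose_prime) auto
    then obtain c where c: "p choose k = p * c" by blast
    have z: "add_pow R p z = \<zero>" if "z \<in> carrier R" for z
      using add_pow_ldistr[of \<one> z p] assms(2) that by simp
    show ?thesis unfolding f_def c using assms z
      by (simp add: add.nat_pow_pow[symmetric] mult.commute[of p] del: add.nat_pow_pow)
  qed
  then have mid: "(\<Oplus>k\<in>{0<..<p}. f k) = \<zero>" by (intro add.finprod_one_eqI) auto
  have "{..p} = insert 0 (insert p {0<..<p})" using p by auto
  then have "(x \<oplus> y) [^] p = (\<Oplus>k\<in>insert 0 (insert p {0<..<p}). f k)"
    using binomial_sum[OF assms(3,4), of p] by (simp add: f_def)
  also have "\<dots> = f 0 \<oplus> f p"
    using p by (simp add: finsum_insert mid)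
  also have "\<dots> = x [^] p \<oplus> y [^] p"
    using assms(3,4) by (simp add: f_def a_comm)
  finally show ?thesis .
qed

lemma (in cring) frobenius_pow_add:
  fixes p e :: nat
  assumes "Factorial_Ring.prime p" "add_pow R p \<one> = \<zero>" "x \<in> carrier R" "y \<in> carrier R"
  shows "(x \<oplus> y) [^] (p ^ e) = x [^] (p ^ e) \<oplus> y [^] (p ^ e)"
proof (induction e)
  case 0
  then show ?case using assms by simp
next
  case (Suc e)
  have *: "z [^] (p ^ Suc e) = (z [^] (p ^ e)) [^] p" if "z \<in> carrier R" for z
    using that by (simp add: nat_pow_pow mult.commute)
  show ?case using assms Suc.IH frobenius_add[OF assms(1,2)] by (simp only: * a_closed nat_pow_closed)
qed

lemma (in cring) frobenius_fixed_subring: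
  fixes p e :: nat
  assumes "Factorial_Ring.prime p" "add_pow R p \<one> = \<zero>"
  shows "subring {x \<in> carrier R. x [^] (p ^ e) = x} R"
proof (rule subringI)
  let ?F = "{x \<in> carrier R. x [^] (p ^ e) = x}"
  have pe: "p ^ e \<noteq> 0" using assms(1) by (auto dest: prime_gt_0_nat)
  show "\<ominus> h \<in> ?F" if "h \<in> ?F" for h
  proof -
    have h: "h \<in> carrier R" "h [^] (p ^ e) = h" using that by auto
    \<comment> \<open>Negatives are obtained from additivity rather than from the sign (-1)^(p^e),
      which avoids a separate case p = 2.\<close>
    have "h \<oplus> (\<ominus> h) [^] (p ^ e) = (h \<oplus> \<ominus> h) [^] (p ^ e)"
      using frobenius_pow_add[OF assms, of h "\<ominus> h" e] h by simp
    also have "\<dots> = \<zero>" using h pe by (simp add: r_neg nat_pow_zero)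
    finally have "(\<ominus> h) [^] (p ^ e) = \<ominus> h" 
      using h by (metis a_inv_closed add.inv_equality add.m_comm nat_pow_closed minus_minus)
    then show ?thesis using h by simp
  qed
qed (use frobenius_pow_add[OF assms] in \<open>auto simp: nat_pow_distrib\<close>)

text \<open>Euclid's algorithm on exponents: removing the multiple p^(n - d) (p^d - 1) replaces n by
  n - d. The case d = 0 is split off because n would not decrease. The lemma turns divisibility of
  orders of multiplicative groups into divisibility of degrees.\<close>

lemma power_diff_one_dvd_iff:
  fixes p d n :: nat
  assumes "p > 1"
  shows "p ^ d - 1 dvd p ^ n - 1 \<longleftrightarrow> d dvd n"
proof (induction n rule: less_induct)
  case (less n)
  show ?case
  proof (cases "n < d \<or> d = 0")
    case True
    have "p ^ d - 1 dvd p ^ n - 1 \<longleftrightarrow> n = 0" if "n < d"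
    proof
      assume "p ^ d - 1 dvd p ^ n - 1"
      moreover have "p ^ n - 1 < p ^ d - 1" 
        using power_strict_increasing[OF that assms] assms by (simp add: diff_less_mono)
      ultimately have "p ^ n - 1 = 0" by (meson dvd_imp_le not_less gr0I)
      then show "n = 0" using one_less_power[OF assms, of n] by (cases n) auto
    qed simp
    moreover have "p ^ 0 - 1 dvd p ^ n - 1 \<longleftrightarrow> n = 0"
      using one_less_power[OF assms, of n] by (cases n) auto
    ultimately show ?thesis using True by (auto dest: dvd_imp_le)
  next
    case False
    then have d: "d \<le> n" "d > 0" by auto
    have "p ^ n - 1 = p ^ (n - d) * (p ^ d - 1) + (p ^ (n - d) - 1)"
      using d(1) assms by (simp add: diff_mult_distrib2 flip: power_add)
    then have "p ^ d - 1 dvd p ^ n - 1 \<longleftrightarrow> p ^ d - 1 dvd p ^ (n - d) - 1"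
      by (metis dvd_add_right_iff dvd_triv_right)
    also have "\<dots> \<longleftrightarrow> d dvd n - d" using less.IH[of "n - d"] d by simp
    also have "\<dots> \<longleftrightarrow> d dvd n" using d(1) by (simp add: dvd_minus_self)
    finally show ?thesis .
  qed
qed

text \<open>The inverse of k is the power k^(ord k - 1), which lies in every subring containing k.
  Hence the image of any subring in the residue field is a subfield.\<close>

lemma (in field) finite_subring_is_subfield:
  assumes "finite (carrier R)" "subring S R"
  shows "subfield S R"
proof (rule subfieldI'[OF assms(2)])
  fix k assume k: "k \<in> S - {\<zero>}"
  then have kc: "k \<in> carrier R" "k \<noteq> \<zero>" using subringE(1)[OF assms(2)] by auto
  interpret G: group "Multiplicative_Group.mult_of R"
    by (rule field_mult_group)
  have pow: "k [^] i \<in> S" for i :: nat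
    by (induction i) (use k subringE[OF assms(2)] in auto)
  have fin: "finite (carrier (Multiplicative_Group.mult_of R))" using assms(1) by simp
  have km: "k \<in> carrier (Multiplicative_Group.mult_of R)" using kc by simp
  have "G.ord k \<ge> 1" using G.ord_ge_1[OF fin km] .
  moreover have "k [^] G.ord k = \<one>" using G.pow_ord_eq_1[OF km] by (simp add: Multiplicative_Group.nat_pow_mult_of)
  ultimately have "k [^] (G.ord k - 1) \<otimes> k = \<one>"
    by (metis Suc_pred' less_eq_Suc_le nat_pow_Suc One_nat_def)
  then have "inv k = k [^] (G.ord k - 1)"
    using kc comm_inv_char[of k "k [^] (G.ord k - 1)"] m_comm by simp
  then show "inv k \<in> S" using pow by simp
qed

section \<open>Subfields of a field with p^n elements\<close>

context field
begin

context
  fixes p n :: nat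
  assumes prime_p: "Factorial_Ring.prime p" and card_R: "card (carrier R) = p ^ n" and n_pos: "n > 0"
begin

private lemma p_gt_1: "p > 1" using prime_p prime_gt_1_nat by blast

lemma finite_carrier_of_card: "finite (carrier R)"
  using card_R p_gt_1 by (intro card_ge_0_finite) simp

text \<open>Lagrange in the additive group gives p^n \<one> = \<zero>. Since p^n \<one> is the n-th
  power of p \<one>, a field forces p \<one> = \<zero>.\<close>

lemma char_of_card: "add_pow R p \<one> = \<zero>"
proof -
  have "add_pow R (order (add_monoid R)) \<one> = \<zero>"
    using add.pow_order_eq_1[of \<one>] by simp
  then have 0: "add_pow R (p ^ n) \<one> = \<zero>" using card_R by (simp add: order_def)
  have "add_pow R (p ^ i) \<one> = (add_pow R p \<one>) [^] i" for i :: nat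
  proof (induction i)
    case (Suc i)
    have "add_pow R (p ^ Suc i) \<one> = add_pow R p (add_pow R (p ^ i) \<one>)"
      by (simp add: add.nat_pow_pow mult.commute)
    also have "\<dots> = add_pow R (p ^ i) \<one> \<otimes> add_pow R p \<one>"
      using add_pow_rdistr[of "add_pow R (p ^ i) \<one>" \<one> p] by simp
    finally show ?case using Suc by simp
  qed simp
  then have "(add_pow R p \<one>) [^] n = \<zero>" using 0 by simp
  moreover have "x [^] i \<noteq> \<zero>" if "x \<in> carrier R" "x \<noteq> \<zero>" for x and i :: nat
    by (induction i) (use that integral in auto)
  ultimately show ?thesis by blast
qed

text \<open>The fixed field of the d-th iterate of Frobenius. It has p^d elements only when d
  divides n; in general its degree is the gcd of d and n, hence the divisibility hypotheses
  below.\<close>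

definition frob_fixed :: "nat \<Rightarrow> 'a set"
  where "frob_fixed d = {x \<in> carrier R. x [^] (p ^ d) = x}"

lemma frob_fixed_subfield: "subfield (frob_fixed d) R"
  unfolding frob_fixed_def
  by (rule finite_subring_is_subfield[OF finite_carrier_of_card
        frobenius_fixed_subring[OF prime_p char_of_card]])

lemma frob_fixed_diff_zero:
  "frob_fixed d - {\<zero>} = {x \<in> carrier R - {\<zero>}. x [^] (p ^ d - 1) = \<one>}"
proof -
  have "x [^] (p ^ d) = x \<longleftrightarrow> x [^] (p ^ d - 1) = \<one>" if "x \<in> carrier R" "x \<noteq> \<zero>" for x
  proof -
    have "x [^] (p ^ d) = x [^] (p ^ d - 1) \<otimes> x"
      using p_gt_1 that by (metis Suc_pred' nat_pow_Suc zero_less_power less_trans zero_less_one)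
    then show ?thesis using that m_rcancel[of x "x [^] (p ^ d - 1)" \<one>] by simp
  qed
  then show ?thesis unfolding frob_fixed_def by auto
qed

text \<open>Both bounds concern the equation x^(p^d - 1) = \<one>. It has at most p^d - 1 roots.
  Conversely, if a generates the multiplicative group and c = (p^n - 1)/(p^d - 1), then a^c has
  order p^d - 1 and its powers are that many roots.\<close>

lemma card_frob_fixed:
  assumes "d dvd n"
  shows "card (frob_fixed d) = p ^ d"
proof -
  interpret G: group "Multiplicative_Group.mult_of R"
    by (rule field_mult_group)
  have fin: "finite (carrier (Multiplicative_Group.mult_of R))" using finite_carrier_of_card by simp
  have d0: "d > 0" using assms n_pos by (auto intro: gr0I)
  have pd: "p ^ d > 1" using one_less_power[OF p_gt_1 d0] .
  let ?U = "frob_fixed d - {\<zero>}"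
  have U: "?U = {x \<in> carrier R - {\<zero>}. x [^] (p ^ d - 1) = \<one>}" by (rule frob_fixed_diff_zero)
  have order: "order (Multiplicative_Group.mult_of R) = p ^ n - 1"
    using card_R finite_carrier_of_card by (simp add: order_def card_Diff_singleton)
  obtain c where c: "p ^ n - 1 = (p ^ d - 1) * c"
    using assms power_diff_one_dvd_iff[OF p_gt_1] by blast
  have pn: "p ^ n - 1 > 0" using one_less_power[OF p_gt_1 n_pos] by simp
  then have c0: "c > 0" using c by (auto intro: gr0I)
  obtain a where a: "a \<in> carrier (Multiplicative_Group.mult_of R)" "carrier (Multiplicative_Group.mult_of R) = {a [^] i | i::nat. i \<in> UNIV}"
    using finite_field_mult_group_has_gen[OF finite_carrier_of_card] by blast
  have "G.ord a = p ^ n - 1"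
  proof -
    have "carrier (Multiplicative_Group.mult_of R) = {a [^]\<^bsub>Multiplicative_Group.mult_of R\<^esub> i | i::nat. i \<in> UNIV}"
      using a(2) by (simp add: Multiplicative_Group.nat_pow_mult_of)
    then have "carrier (Multiplicative_Group.mult_of R) = generate (Multiplicative_Group.mult_of R) {a}"
      using G.generate_pow_nat[OF a(1)] G.ord_ge_1[OF fin a(1)] by auto
    then show ?thesis using G.generate_pow_card[OF a(1)] order by (simp add: order_def)
  qed
  then have ord: "G.ord (a [^]\<^bsub>Multiplicative_Group.mult_of R\<^esub> c) = p ^ d - 1"
    using G.ord_pow_gen[OF a(1), of c] c c0 by simp
  define b where "b = a [^]\<^bsub>Multiplicative_Group.mult_of R\<^esub> c"
  have b: "b \<in> carrier (Multiplicative_Group.mult_of R)" unfolding b_def using a(1) by (rule G.nat_pow_closed)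
  have "(\<lambda>i::nat. b [^]\<^bsub>Multiplicative_Group.mult_of R\<^esub> i) ` {0..p ^ d - 1 - 1} \<subseteq> ?U"
  proof
    fix x assume "x \<in> (\<lambda>i::nat. b [^]\<^bsub>Multiplicative_Group.mult_of R\<^esub> i) ` {0..p ^ d - 1 - 1}"
    then obtain i :: nat where i: "x = b [^]\<^bsub>Multiplicative_Group.mult_of R\<^esub> i" by blast
    have xG: "x \<in> carrier (Multiplicative_Group.mult_of R)" using i b G.nat_pow_closed by blast
    have "x [^]\<^bsub>Multiplicative_Group.mult_of R\<^esub> (p ^ d - 1) = (b [^]\<^bsub>Multiplicative_Group.mult_of R\<^esub> (p ^ d - 1)) [^]\<^bsub>Multiplicative_Group.mult_of R\<^esub> i"
      unfolding i using b by (simp add: G.nat_pow_pow mult.commute)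
    also have "\<dots> = \<one>\<^bsub>Multiplicative_Group.mult_of R\<^esub>" using G.pow_ord_eq_1[OF b] ord
      by (simp add: b_def Multiplicative_Group.nat_pow_mult_of)
    finally show "x \<in> ?U" unfolding U using xG by (simp add: Multiplicative_Group.nat_pow_mult_of)
  qed
  moreover have "card ((\<lambda>i::nat. b [^]\<^bsub>Multiplicative_Group.mult_of R\<^esub> i) ` {0..p ^ d - 1 - 1}) = p ^ d - 1"
  proof -
    have "inj_on (\<lambda>i::nat. b [^]\<^bsub>Multiplicative_Group.mult_of R\<^esub> i) {0..p ^ d - 1 - 1}"
      using G.ord_inj[OF b] ord by (simp add: b_def)
    then show ?thesis using pd by (simp add: card_image)
  qed
  moreover have finU: "finite ?U" unfolding U using finite_carrier_of_card by simp
  ultimately have 1: "p ^ d - 1 \<le> card ?U" using card_mono by metis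
  have "card {x \<in> carrier R. x [^] (p ^ d - 1) = \<one>} \<le> p ^ d - 1"
    using num_roots_le_deg[OF finite_carrier_of_card, of "p ^ d - 1"] pd by simp
  moreover have "card ?U \<le> card {x \<in> carrier R. x [^] (p ^ d - 1) = \<one>}"
    unfolding U using finite_carrier_of_card by (intro card_mono) auto
  ultimately have "card ?U = p ^ d - 1" using 1 by simp
  moreover have "\<zero> \<in> frob_fixed d" using subringE(2)[OF subfieldE(1)[OF frob_fixed_subfield]] .
  moreover have "finite (frob_fixed d)" using finU by simp
  ultimately show ?thesis using pd card_Suc_Diff1[of "frob_fixed d" \<zero>] by simp
qed

text \<open>Lagrange is used three times: additively for card F = p^d, multiplicatively for p^d - 1
  dividing p^n - 1 and so d dividing n, and inside the multiplicative group of F to place F in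
  \<open>frob_fixed d\<close>. Equal sizes then give equality.\<close>

lemma subfield_eq_frob_fixed:
  assumes "subfield F R"
  shows "\<exists>d. d dvd n \<and> F = frob_fixed d"
proof -
  interpret G: group "Multiplicative_Group.mult_of R"
    by (rule field_mult_group)
  have F: "subring F R" "F \<subseteq> carrier R" using subfieldE[OF assms] by auto
  have finF: "finite F" using F finite_carrier_of_card finite_subset by blast
  have "card (a_rcosets F) * card F = p ^ n"
    using a_lagrange[OF finite_carrier_of_card, of F] F(1) card_R 
    by (simp add: order_def additive_subgroup_def subring.axioms(1))
  then have "card F dvd p ^ n" by (metis dvd_triv_right)
  then obtain d where d: "card F = p ^ d" using divides_primepow_nat[OF prime_p] by blast
  have U: "subgroup (F - {\<zero>}) (Multiplicative_Group.mult_of R)" using subgroup_mult_of[OF assms] .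
  have cU: "card (F - {\<zero>}) = p ^ d - 1" using d subringE(2)[OF F(1)] by (simp add: card_Diff_singleton)
  have order: "order (Multiplicative_Group.mult_of R) = p ^ n - 1"
    using card_R finite_carrier_of_card by (simp add: order_def card_Diff_singleton)
  have "p ^ d - 1 dvd p ^ n - 1"
    using G.lagrange[OF U] cU order by (metis dvd_triv_right)
  then have dn: "d dvd n" using power_diff_one_dvd_iff[OF p_gt_1] by blast
  have "F - {\<zero>} \<subseteq> frob_fixed d - {\<zero>}"
  proof
    fix x assume x: "x \<in> F - {\<zero>}"
    let ?H = "(Multiplicative_Group.mult_of R)\<lparr>carrier := F - {\<zero>}\<rparr>"
    interpret H: group ?H using G.subgroup_imp_group[OF U] .
    have "x [^]\<^bsub>?H\<^esub> (p ^ d - 1) = \<one>\<^bsub>?H\<^esub>"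
      using H.pow_order_eq_1[of x] x cU by (simp add: order_def)
    then have "x [^] (p ^ d - 1) = \<one>"
      using G.nat_pow_consistent[of x "p ^ d - 1" "F - {\<zero>}"] by (simp add: Multiplicative_Group.nat_pow_mult_of)
    then show "x \<in> frob_fixed d - {\<zero>}" unfolding frob_fixed_diff_zero using x F by auto
  qed
  then have "F \<subseteq> frob_fixed d" using subringE(2)[OF subfieldE(1)[OF frob_fixed_subfield]] by blast
  moreover have "finite (frob_fixed d)" unfolding frob_fixed_def using finite_carrier_of_card by simp
  ultimately have "F = frob_fixed d" using card_subset_eq d card_frob_fixed[OF dn] by metis
  then show ?thesis using dn by blast
qed

lemma frob_fixed_subset_iff:
  assumes "d dvd n" "e dvd n"
  shows "frob_fixed d \<subseteq> frob_fixed e \<longleftrightarrow> d dvd e"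
proof
  assume "d dvd e"
  then obtain c where c: "p ^ e - 1 = (p ^ d - 1) * c"
    using power_diff_one_dvd_iff[OF p_gt_1] by blast
  have "frob_fixed d - {\<zero>} \<subseteq> frob_fixed e - {\<zero>}"
    unfolding frob_fixed_diff_zero c by (auto simp flip: nat_pow_pow)
  then show "frob_fixed d \<subseteq> frob_fixed e"
    using subringE(2)[OF subfieldE(1)[OF frob_fixed_subfield]] by blast
next
  assume sub: "frob_fixed d \<subseteq> frob_fixed e"
  interpret G: group "Multiplicative_Group.mult_of R"
    by (rule field_mult_group)
  have U: "subgroup (frob_fixed f - {\<zero>}) (Multiplicative_Group.mult_of R)" for f 
    using subgroup_mult_of[OF frob_fixed_subfield] .
  have c: "card (frob_fixed f - {\<zero>}) = p ^ f - 1" if "f dvd n" for f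
    using card_frob_fixed[OF that] subringE(2)[OF subfieldE(1)[OF frob_fixed_subfield]]
    by (simp add: card_Diff_singleton)
  let ?H = "(Multiplicative_Group.mult_of R)\<lparr>carrier := frob_fixed e - {\<zero>}\<rparr>"
  interpret H: group ?H using G.subgroup_imp_group[OF U] .
  have "subgroup (frob_fixed d - {\<zero>}) ?H"
    using G.subgroup_incl[OF U U] sub by blast
  then have "p ^ d - 1 dvd p ^ e - 1"
    using H.lagrange[of "frob_fixed d - {\<zero>}"] c assms by (simp add: order_def) (metis dvd_triv_right)
  then show "d dvd e" using power_diff_one_dvd_iff[OF p_gt_1] by blast
qed

lemma frob_fixed_eq_iff:
  assumes "d dvd n" "e dvd n"
  shows "frob_fixed d = frob_fixed e \<longleftrightarrow> d = e"
  using frob_fixed_subset_iff[OF assms] frob_fixed_subset_iff[OF assms(2,1)] dvd_antisym by blast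

lemma frob_fixed_n: "frob_fixed n = carrier R"
proof (rule card_subset_eq[OF finite_carrier_of_card])
  show "frob_fixed n \<subseteq> carrier R" unfolding frob_fixed_def by blast
qed (simp add: card_R card_frob_fixed)

text \<open>The lattice of subfields is the lattice of divisors of n, and the maximal proper
  divisors are n/r with r prime.\<close>

lemma max_subfield_frob_fixed_iff:
  assumes "d dvd n"
  shows "max_subfield R (frob_fixed d) \<longleftrightarrow> (\<exists>r\<in>prime_factors n. d = n div r)"
proof -
  have "max_subfield R (frob_fixed d) \<longleftrightarrow> d \<noteq> n \<and> (\<forall>e. e dvd n \<and> d dvd e \<and> e \<noteq> n \<longrightarrow> e = d)"
    (is "_ \<longleftrightarrow> ?max")
  proof -
    have "max_subfield R (frob_fixed d) \<longleftrightarrow> frob_fixed d \<noteq> carrier R \<and>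
      (\<forall>e. e dvd n \<and> frob_fixed d \<subseteq> frob_fixed e \<and> frob_fixed e \<noteq> carrier R \<longrightarrow> frob_fixed e = frob_fixed d)"
      unfolding max_subfield_def using frob_fixed_subfield subfield_eq_frob_fixed by metis
    then show ?thesis
      using assms frob_fixed_subset_iff frob_fixed_eq_iff frob_fixed_eq_iff[OF _ dvd_refl]
      unfolding frob_fixed_n by (simp cong: conj_cong)
  qed
  also have "\<dots> \<longleftrightarrow> (\<exists>r\<in>prime_factors n. d = n div r)"
  proof
    assume max: ?max
    obtain s where s: "n = d * s" using assms by blast
    then have "s \<noteq> 1" using max by auto
    then obtain r where r: "Factorial_Ring.prime r" "r dvd s" using prime_factor_nat by blast
    then obtain t where t: "s = r * t" by blast
    have r0: "r > 1" using prime_gt_1_nat r(1) by blast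
    have e: "n div r = d * t" using s t r0 by simp
    have nr: "n = (d * t) * r" using s t by simp
    have "d * t \<noteq> n" using nr r0 n_pos by auto
    then have "d * t = d" using max nr by (metis dvd_triv_left)
    moreover have "r \<in> prime_factors n" using r s n_pos by (intro prime_factorsI) auto
    ultimately show "\<exists>r\<in>prime_factors n. d = n div r" using e by auto
  next
    assume "\<exists>r\<in>prime_factors n. d = n div r"
    then obtain r where r: "Factorial_Ring.prime r" "r dvd n" "d = n div r" 
      by (auto simp: prime_factors_dvd)
    have n: "n = d * r" using r by simp
    have r1: "r > 1" using r(1) prime_gt_1_nat by blast
    have d0: "d > 0" using n n_pos by (auto intro: gr0I)
    have "e = d" if e: "e dvd n" "d dvd e" "e \<noteq> n" for e
    proof -
      obtain t where t: "e = d * t" using e(2) by blast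
      then have "t dvd r" using e(1) n d0 by simp
      then have "t = 1 \<or> t = r" using r(1) by (simp add: prime_nat_iff)
      then show ?thesis using t e(3) n by auto
    qed
    moreover have "d \<noteq> n" using n r1 d0 by auto
    ultimately show ?max by blast
  qed
  finally show ?thesis .
qed

lemma card_max_subfields: "card {F. max_subfield R F} = card (prime_factors n)"
proof -
  have "bij_betw (\<lambda>r. frob_fixed (n div r)) (prime_factors n) {F. max_subfield R F}"
    unfolding bij_betw_def
  proof
    have dv: "n div r dvd n" if "r \<in> prime_factors n" for r
      using that by (metis dvd_div_mult_self dvd_triv_left in_prime_factors_iff)
    show "inj_on (\<lambda>r. frob_fixed (n div r)) (prime_factors n)"
    proof (rule inj_onI)
      fix r s assume rs: "r \<in> prime_factors n" "s \<in> prime_factors n"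
        "frob_fixed (n div r) = frob_fixed (n div s)"
      then have eq: "n div r = n div s" using frob_fixed_eq_iff dv by blast
      have "r dvd n" "s dvd n" using rs by auto
      then have nr: "n div r * r = n" "n div s * s = n" by simp_all
      then have "n div r \<noteq> 0" using n_pos by (metis mult_0 less_numeral_extra(3))
      then show "r = s" using nr eq by (metis mult_left_cancel)
    qed
    show "(\<lambda>r. frob_fixed (n div r)) ` prime_factors n = {F. max_subfield R F}"
    proof (intro subset_antisym subsetI)
      fix F assume "F \<in> (\<lambda>r. frob_fixed (n div r)) ` prime_factors n"
      then show "F \<in> {F. max_subfield R F}"
        using max_subfield_frob_fixed_iff dv by auto
    next
      fix F assume "F \<in> {F. max_subfield R F}"
      then have F: "max_subfield R F" by simp
      then have "subfield F R" unfolding max_subfield_def by simp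
      from subfield_eq_frob_fixed[OF this] obtain d where d: "d dvd n" "F = frob_fixed d"
        by (elim exE conjE)
      then obtain r where "r \<in> prime_factors n" "d = n div r"
        using F max_subfield_frob_fixed_iff[OF d(1)] by auto
      then show "F \<in> (\<lambda>r. frob_fixed (n div r)) ` prime_factors n"
        using d(2) by blast
    qed
  qed
  then show ?thesis using bij_betw_same_card by metis
qed

end

end

section \<open>Integer polynomials modulo \<open>M\<close>\<close>

text \<open>Coefficients are listed from the leading one down and \<open>[]\<close> is the zero
  polynomial; \<open>normalize\<close> strips the leading zeros that reduction may create.\<close>

definition red_poly :: "int \<Rightarrow> int list \<Rightarrow> int list"
  where "red_poly M g = ring.normalize (residue_ring M) (map (\<lambda>c. c mod M) g)"

text \<open>Coefficients act as integer multiples of the unit, with no modulus mentioned. The same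
  list can thus be evaluated in R and in R/m, and read as a polynomial over Z, Z/p^N or Z/p.\<close>

definition int_eval :: "('a, 'b) ring_scheme \<Rightarrow> 'a \<Rightarrow> int list \<Rightarrow> 'a"
  where "int_eval Q x g = ring.eval Q (map (\<lambda>c. add_pow Q c \<one>\<^bsub>Q\<^esub>) g) x"

lemma (in ring) poly_mult_normalize_right:
  assumes "set p \<subseteq> carrier R" "set q \<subseteq> carrier R"
  shows "poly_mult p q = poly_mult p (normalize q)"
proof -
  have q: "set (normalize q) \<subseteq> carrier R" using normalize_in_carrier[OF assms(2)] .
  have "coeff (poly_mult p q) = coeff (poly_mult p (normalize q))"
    using poly_mult_coeff[OF assms] poly_mult_coeff[OF assms(1) q] normalize_coeff[of q] by simp
  then show ?thesis
    using coeff_iff_polynomial_cond[OF poly_mult_is_polynomial[OF carrier_is_subring assms]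
        poly_mult_is_polynomial[OF carrier_is_subring assms(1) q]] by simp
qed

lemma (in ring) add_pow_int_hom: "ring_hom_ring \<Z> R (\<lambda>c. add_pow R (c::int) \<one>)"
proof (rule ring_hom_ringI)
  show "ring \<Z>" by (rule int.ring_axioms)
  show "add_pow R (c \<otimes>\<^bsub>\<Z>\<^esub> d) \<one> = add_pow R c \<one> \<otimes> add_pow R d \<one>" for c d
  proof -
    have "add_pow R c \<one> \<otimes> add_pow R d \<one> = add_pow R c (add_pow R d \<one>)"
      using add_pow_ldistr_int[of \<one> "add_pow R d \<one>" c] by simp
    also have "\<dots> = add_pow R (d * c) \<one>" by (rule add.int_pow_pow) simp
    finally show ?thesis by (simp add: mult.commute)
  qed
  show "add_pow R (c \<oplus>\<^bsub>\<Z>\<^esub> d) \<one> = add_pow R c \<one> \<oplus> add_pow R d \<one>" for c d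
    by (simp add: add.int_pow_mult)
qed (auto simp: ring_axioms)

context
  fixes M :: int assumes M: "M > 1"
begin

interpretation A: residues M "residue_ring M"
  by unfold_locales (rule M)

lemma mod_hom: "ring_hom_ring \<Z> (residue_ring M) (\<lambda>c. c mod M)"
  by (rule ring_hom_ringI)
    (use M in \<open>auto simp: int.ring_axioms A.ring_axioms A.res_carrier_eq A.res_mult_eq A.res_add_eq
      A.res_one_eq mod_simps\<close>)

interpretation h: ring_hom_ring \<Z> "residue_ring M" "\<lambda>c. c mod M" by (rule mod_hom)

lemma set_map_mod: "set (map (\<lambda>c. c mod M) g) \<subseteq> carrier (residue_ring M)"
  using M by (auto simp: A.res_carrier_eq)

lemma red_poly_closed: "red_poly M g \<in> carrier (poly_ring (residue_ring M))"
  unfolding red_poly_def univ_poly_carrier[symmetric]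
  by (rule A.normalize_gives_polynomial[OF set_map_mod])

lemma red_poly_length: "length (red_poly M g) \<le> length g"
  unfolding red_poly_def using A.normalize_length_le[of "map (\<lambda>c. c mod M) g"] by simp

text \<open>Residues are the integers 0..M - 1, so a polynomial over Z/M is literally an integer
  polynomial and serves as its own lift. This section of the reduction map transports identities
  from Z[x].\<close>

lemma red_poly_id:
  assumes "g \<in> carrier (poly_ring (residue_ring M))"
  shows "red_poly M g = g" "g \<in> carrier (poly_ring \<Z>)"
proof -
  have g: "polynomial\<^bsub>residue_ring M\<^esub> (carrier (residue_ring M)) g" 
    using assms unfolding univ_poly_carrier .
  then have "c mod M = c" if "c \<in> set g" for c
    using that A.polynomial_incl[OF g] by (auto simp: A.res_carrier_eq subset_iff)
  then have "map (\<lambda>c. c mod M) g = g" by (intro map_idI) auto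
  then show "red_poly M g = g" unfolding red_poly_def using A.normalize_polynomial[OF g] by simp
  show "g \<in> carrier (poly_ring \<Z>)"
    using g unfolding univ_poly_carrier[symmetric] polynomial_def by (auto simp: A.res_zero_eq)
qed

lemma red_poly_hom: "red_poly M \<in> ring_hom (poly_ring \<Z>) (poly_ring (residue_ring M))"
proof (rule ring_hom_memI)
  fix P Q
  show "red_poly M P \<in> carrier (poly_ring (residue_ring M))" by (rule red_poly_closed)
  note s = set_map_mod[of P] set_map_mod[of Q]
  show "red_poly M (P \<otimes>\<^bsub>poly_ring \<Z>\<^esub> Q) = red_poly M P \<otimes>\<^bsub>poly_ring (residue_ring M)\<^esub> red_poly M Q"
    unfolding red_poly_def univ_poly_mult
    using h.poly_mult_hom'[of P Q] A.poly_mult_normalize[OF s] A.poly_mult_normalize_right[OF A.normalize_in_carrier[OF s(1)] s(2)] by simp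
  show "red_poly M (P \<oplus>\<^bsub>poly_ring \<Z>\<^esub> Q) = red_poly M P \<oplus>\<^bsub>poly_ring (residue_ring M)\<^esub> red_poly M Q"
    unfolding red_poly_def univ_poly_add
    using h.poly_add_hom'[of P Q] A.poly_add_normalize[OF s] by simp
next
  show "red_poly M \<one>\<^bsub>poly_ring \<Z>\<^esub> = \<one>\<^bsub>poly_ring (residue_ring M)\<^esub>"
    using M by (simp add: red_poly_def univ_poly_one A.res_one_eq A.res_zero_eq)
qed

lemma red_poly_image: "red_poly M ` carrier (poly_ring \<Z>) = carrier (poly_ring (residue_ring M))"
proof
  show "red_poly M ` carrier (poly_ring \<Z>) \<subseteq> carrier (poly_ring (residue_ring M))"
    using red_poly_closed by blast
  show "carrier (poly_ring (residue_ring M)) \<subseteq> red_poly M ` carrier (poly_ring \<Z>)"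
  proof
    fix g assume "g \<in> carrier (poly_ring (residue_ring M))"
    from red_poly_id[OF this] show "g \<in> red_poly M ` carrier (poly_ring \<Z>)"
      by (metis (no_types) image_eqI)
  qed
qed

interpretation ZX: domain "poly_ring \<Z>"
  by (rule domain.univ_poly_is_domain[OF int.domain_axioms ring.carrier_is_subring[OF int.ring_axioms]])

text \<open>M may be composite, so the coefficients need not form a domain. The ring structure is
  obtained as the image of the domain Z[x] under reduction.\<close>

lemma poly_ring_residue_cring: "cring (poly_ring (residue_ring M))"
proof -
  have z: "red_poly M \<zero>\<^bsub>poly_ring \<Z>\<^esub> = \<zero>\<^bsub>poly_ring (residue_ring M)\<^esub>"
    by (simp add: red_poly_def univ_poly_zero)
  have "ring (poly_ring (residue_ring M))"
    using ZX.ring_hom_imp_img_ring[OF red_poly_hom] unfolding red_poly_image z by simp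
  then interpret AX: ring "poly_ring (residue_ring M)" .
  show ?thesis
  proof unfold_locales
    fix P Q assume PQ: "P \<in> carrier (poly_ring (residue_ring M))" "Q \<in> carrier (poly_ring (residue_ring M))"
    note Z = red_poly_id[OF PQ(1)] red_poly_id[OF PQ(2)]
    show "P \<otimes>\<^bsub>poly_ring (residue_ring M)\<^esub> Q = Q \<otimes>\<^bsub>poly_ring (residue_ring M)\<^esub> P"
      using ring_hom_mult[OF red_poly_hom Z(2,4)] ring_hom_mult[OF red_poly_hom Z(4,2)]
        ZX.m_comm[OF Z(2,4)] Z(1,3) by simp
  qed
qed

interpretation AX: cring "poly_ring (residue_ring M)" by (rule poly_ring_residue_cring)

text \<open>The leading coefficient 1 is a unit of Z, so the division takes place in Z[x] and is
  then reduced modulo M. Reduction fixes f and g and cannot lengthen the remainder.\<close>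

lemma monic_division:
  assumes f: "f \<in> carrier (poly_ring (residue_ring M))" "f \<noteq> []" "lead_coeff f = 1"
    and g: "g \<in> carrier (poly_ring (residue_ring M))"
  shows "\<exists>h\<in>carrier (poly_ring (residue_ring M)). \<exists>r\<in>carrier (poly_ring (residue_ring M)).
    g = (f \<otimes>\<^bsub>poly_ring (residue_ring M)\<^esub> h) \<oplus>\<^bsub>poly_ring (residue_ring M)\<^esub> r \<and> length r < length f"
proof -
  note F = red_poly_id[OF f(1)] and G = red_poly_id[OF g]
  have "lead_coeff f \<in> Units (\<Z>\<lparr>carrier := carrier \<Z>\<rparr>)" unfolding f(3) Units_def by auto
  then obtain h r where hr: "h \<in> carrier (poly_ring \<Z>)" "r \<in> carrier (poly_ring \<Z>)"
      "g = (f \<otimes>\<^bsub>poly_ring \<Z>\<^esub> h) \<oplus>\<^bsub>poly_ring \<Z>\<^esub> r" "r = [] \<or> degree r < degree f"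
    using domain.long_division_theorem[OF int.domain_axioms ring.carrier_is_subring[OF int.ring_axioms], of g f] F(2) G(2) f(2)
    unfolding univ_poly_carrier[symmetric] by auto
  have "g = red_poly M ((f \<otimes>\<^bsub>poly_ring \<Z>\<^esub> h) \<oplus>\<^bsub>poly_ring \<Z>\<^esub> r)" using hr(3) G(1) by simp
  also have "\<dots> = (f \<otimes>\<^bsub>poly_ring (residue_ring M)\<^esub> red_poly M h) \<oplus>\<^bsub>poly_ring (residue_ring M)\<^esub> red_poly M r"
    using ring_hom_add[OF red_poly_hom ZX.m_closed[OF F(2) hr(1)] hr(2)]
      ring_hom_mult[OF red_poly_hom F(2) hr(1)] F(1) by simp
  finally have "g = (f \<otimes>\<^bsub>poly_ring (residue_ring M)\<^esub> red_poly M h) \<oplus>\<^bsub>poly_ring (residue_ring M)\<^esub> red_poly M r" .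
  \<comment> \<open>Lengths are compared because \<open>degree\<close> is 0 both for the zero
    polynomial and for nonzero constants, whereas the length separates them.\<close>
  moreover have "length r < length f"
    using hr(4) f(2) by (cases f; cases r) auto
  then have "length (red_poly M r) < length f" using red_poly_length[of r] by simp
  ultimately show ?thesis using red_poly_closed by blast
qed

text \<open>Padding with leading zeros to length exactly n is inverse to \<open>normalize\<close>,
  so these polynomials correspond to all lists of n residues.\<close>

lemma card_bounded_polys:
  "finite {r \<in> carrier (poly_ring (residue_ring M)). length r \<le> n}"
  "card {r \<in> carrier (poly_ring (residue_ring M)). length r \<le> n} = nat M ^ n"
proof -
  let ?L = "{xs. set xs \<subseteq> carrier (residue_ring M) \<and> length xs = n}"
  let ?P = "{r \<in> carrier (poly_ring (residue_ring M)). length r \<le> n}"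
  have bij: "bij_betw A.normalize ?L ?P"
  proof (rule bij_betwI[where g = "\<lambda>r. replicate (n - length r) 0 @ r"])
    show "A.normalize \<in> ?L \<rightarrow> ?P"
      using A.normalize_gives_polynomial A.normalize_length_le by (auto simp: univ_poly_carrier[symmetric])
    show "(\<lambda>r. replicate (n - length r) 0 @ r) \<in> ?P \<rightarrow> ?L"
    proof
      fix r assume r: "r \<in> ?P"
      then have "set r \<subseteq> carrier (residue_ring M)"
        using A.polynomial_incl[of "carrier (residue_ring M)" r] by (simp add: univ_poly_carrier)
      moreover have "0 \<in> carrier (residue_ring M)" using M by (simp add: A.res_carrier_eq)
      ultimately show "replicate (n - length r) 0 @ r \<in> ?L" using r by auto
    qed
    show "replicate (n - length (A.normalize xs)) 0 @ A.normalize xs = xs" if "xs \<in> ?L" for xs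
      using A.normalize_trick[of xs] that by (simp add: A.res_zero_eq)
    show "A.normalize (replicate (n - length r) 0 @ r) = r" if "r \<in> ?P" for r
      using A.normalize_replicate_zero[of "n - length r" r] that A.normalize_polynomial
      by (auto simp: A.res_zero_eq univ_poly_carrier[symmetric])
  qed
  have "finite ?L" "card ?L = nat M ^ n"
    using finite_lists_length_eq[OF A.finite, of n] card_lists_length_eq[OF A.finite, of n]
    by (simp_all add: A.res_carrier_eq)
  then show "finite ?P" "card ?P = nat M ^ n"
    using bij_betw_finite[OF bij] bij_betw_same_card[OF bij] by simp_all
qed

section \<open>Evaluation of polynomials over Z/M\<close>

context
  fixes Q :: "('a, 'b) ring_scheme" and x
  assumes Q: "cring Q" and x: "x \<in> carrier Q" and MQ: "add_pow Q M \<one>\<^bsub>Q\<^esub> = \<zero>\<^bsub>Q\<^esub>"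
begin

interpretation Q: cring Q by (rule Q)

interpretation i: ring_hom_ring \<Z> Q "\<lambda>c. add_pow Q (c::int) \<one>\<^bsub>Q\<^esub>"
  by (rule Q.add_pow_int_hom)

lemma set_map_embed: "set (map (\<lambda>c. add_pow Q (c::int) \<one>\<^bsub>Q\<^esub>) g) \<subseteq> carrier Q"
  by auto

lemma int_eval_closed: "int_eval Q x g \<in> carrier Q"
  unfolding int_eval_def by (rule Q.eval_in_carrier[OF set_map_embed x])

lemma add_pow_mod: "add_pow Q (c mod M) \<one>\<^bsub>Q\<^esub> = add_pow Q c \<one>\<^bsub>Q\<^esub>"
proof -
  have "add_pow Q c \<one>\<^bsub>Q\<^esub> = add_pow Q (M * (c div M) + c mod M) \<one>\<^bsub>Q\<^esub>" by simp
  also have "\<dots> = add_pow Q M \<one>\<^bsub>Q\<^esub> \<otimes>\<^bsub>Q\<^esub> add_pow Q (c div M) \<one>\<^bsub>Q\<^esub> \<oplus>\<^bsub>Q\<^esub> add_pow Q (c mod M) \<one>\<^bsub>Q\<^esub>"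
    using i.hom_add[of "M * (c div M)" "c mod M"] i.hom_mult[of M "c div M"] by simp
  also have "\<dots> = add_pow Q (c mod M) \<one>\<^bsub>Q\<^esub>" unfolding MQ by simp
  finally show ?thesis by simp
qed

text \<open>Evaluation factors through reduction: M times the unit vanishes in Q, so c and c mod M
  act alike, and stripped leading zeros contribute nothing. The homomorphism laws for integer lists
  therefore descend to (Z/M)[x].\<close>

lemma int_eval_red_poly: "int_eval Q x (red_poly M g) = int_eval Q x g"
proof -
  let ?e = "map (\<lambda>c. add_pow Q (c::int) \<one>\<^bsub>Q\<^esub>)"
  have "Q.eval (?e (A.normalize L)) x = Q.eval (?e L) x" for L
  proof (induction L)
    case (Cons c L)
    show ?case
    proof (cases "c = 0")
      case True
      have "Q.eval (?e L) x \<in> carrier Q" by (rule Q.eval_in_carrier[OF set_map_embed x])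
      then show ?thesis using True Cons x by (simp add: A.res_zero_eq)
    qed (simp add: A.res_zero_eq)
  qed simp
  then have "int_eval Q x (red_poly M g) = Q.eval (?e (map (\<lambda>c. c mod M) g)) x"
    unfolding red_poly_def int_eval_def by simp
  also have "?e (map (\<lambda>c. c mod M) g) = ?e g" by (simp add: add_pow_mod)
  finally show ?thesis unfolding int_eval_def .
qed

lemma int_eval_add: "int_eval Q x (P \<oplus>\<^bsub>poly_ring \<Z>\<^esub> P') = int_eval Q x P \<oplus>\<^bsub>Q\<^esub> int_eval Q x P'"
proof -
  let ?e = "map (\<lambda>c. add_pow Q (c::int) \<one>\<^bsub>Q\<^esub>)"
  have "Q.eval (?e (ring.poly_add \<Z> P P')) x = Q.eval (Q.normalize (?e (ring.poly_add \<Z> P P'))) x"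
    by (rule Q.eval_normalize[OF set_map_embed x, symmetric])
  also have "Q.normalize (?e (ring.poly_add \<Z> P P')) = Q.poly_add (?e P) (?e P')"
    by (rule i.poly_add_hom') simp_all
  also have "Q.eval \<dots> x = Q.eval (?e P) x \<oplus>\<^bsub>Q\<^esub> Q.eval (?e P') x"
    by (rule Q.eval_poly_add[OF set_map_embed set_map_embed x])
  finally show ?thesis unfolding int_eval_def univ_poly_add .
qed

lemma int_eval_mult: "int_eval Q x (P \<otimes>\<^bsub>poly_ring \<Z>\<^esub> P') = int_eval Q x P \<otimes>\<^bsub>Q\<^esub> int_eval Q x P'"
proof -
  let ?e = "map (\<lambda>c. add_pow Q (c::int) \<one>\<^bsub>Q\<^esub>)"
  have "Q.eval (?e (ring.poly_mult \<Z> P P')) x = Q.eval (Q.normalize (?e (ring.poly_mult \<Z> P P'))) x"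
    by (rule Q.eval_normalize[OF set_map_embed x, symmetric])
  also have "Q.normalize (?e (ring.poly_mult \<Z> P P')) = Q.poly_mult (?e P) (?e P')"
    by (rule i.poly_mult_hom') simp_all
  also have "Q.eval \<dots> x = Q.eval (?e P) x \<otimes>\<^bsub>Q\<^esub> Q.eval (?e P') x"
    by (rule Q.eval_poly_mult[OF set_map_embed set_map_embed x])
  finally show ?thesis unfolding int_eval_def univ_poly_mult .
qed

lemma int_eval_hom: "int_eval Q x \<in> ring_hom (poly_ring (residue_ring M)) Q"
proof (rule ring_hom_memI)
  fix P P' assume P: "P \<in> carrier (poly_ring (residue_ring M))" and P': "P' \<in> carrier (poly_ring (residue_ring M))"
  show "int_eval Q x P \<in> carrier Q" by (rule int_eval_closed)
  note Z = red_poly_id[OF P] red_poly_id[OF P']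
  have "P \<otimes>\<^bsub>poly_ring (residue_ring M)\<^esub> P' = red_poly M (P \<otimes>\<^bsub>poly_ring \<Z>\<^esub> P')"
    using ring_hom_mult[OF red_poly_hom Z(2,4)] Z(1,3) by simp
  then show "int_eval Q x (P \<otimes>\<^bsub>poly_ring (residue_ring M)\<^esub> P') = int_eval Q x P \<otimes>\<^bsub>Q\<^esub> int_eval Q x P'"
    by (simp only: int_eval_red_poly int_eval_mult)
  have "P \<oplus>\<^bsub>poly_ring (residue_ring M)\<^esub> P' = red_poly M (P \<oplus>\<^bsub>poly_ring \<Z>\<^esub> P')"
    using ring_hom_add[OF red_poly_hom Z(2,4)] Z(1,3) by simp
  then show "int_eval Q x (P \<oplus>\<^bsub>poly_ring (residue_ring M)\<^esub> P') = int_eval Q x P \<oplus>\<^bsub>Q\<^esub> int_eval Q x P'"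
    by (simp only: int_eval_red_poly int_eval_add)
next
  show "int_eval Q x \<one>\<^bsub>poly_ring (residue_ring M)\<^esub> = \<one>\<^bsub>Q\<^esub>"
    using x by (simp add: int_eval_def univ_poly_one A.res_one_eq)
qed

lemma int_eval_hom_ring: "ring_hom_ring (poly_ring (residue_ring M)) Q (int_eval Q x)"
  by (rule ring_hom_ringI2[OF AX.ring_axioms Q.ring_axioms int_eval_hom])

end

text \<open>Every coset contains its remainder on division by f, a polynomial of length at most
  \<open>degree f\<close>.\<close>

lemma card_quot_monic_le:
  assumes f: "f \<in> carrier (poly_ring (residue_ring M))" "f \<noteq> []" "lead_coeff f = 1"
  shows "card (carrier (poly_ring (residue_ring M) Quot (PIdl\<^bsub>poly_ring (residue_ring M)\<^esub> f))) \<le> nat M ^ degree f"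
proof -
  let ?AX = "poly_ring (residue_ring M)"
  let ?I = "PIdl\<^bsub>?AX\<^esub> f"
  let ?D = "{r \<in> carrier ?AX. length r \<le> degree f}"
  have I: "ideal ?I ?AX" by (rule AX.cgenideal_ideal[OF f(1)])
  have "carrier (?AX Quot ?I) \<subseteq> (\<lambda>r. ?I +>\<^bsub>?AX\<^esub> r) ` ?D"
  proof
    fix C assume "C \<in> carrier (?AX Quot ?I)"
    then obtain g where g: "g \<in> carrier ?AX" "C = ?I +>\<^bsub>?AX\<^esub> g"
      unfolding FactRing_def A_RCOSETS_def' by auto
    obtain h r where hr: "h \<in> carrier ?AX" "r \<in> carrier ?AX"
      "g = (f \<otimes>\<^bsub>?AX\<^esub> h) \<oplus>\<^bsub>?AX\<^esub> r" "length r < length f"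
      using monic_division[OF f g(1)] by blast
    have fh: "f \<otimes>\<^bsub>?AX\<^esub> h \<in> carrier ?AX" using f(1) hr(1) by (rule AX.m_closed)
    have "g \<ominus>\<^bsub>?AX\<^esub> r = f \<otimes>\<^bsub>?AX\<^esub> h"
      unfolding hr(3) using fh hr(2) by (simp add: a_minus_def AX.a_assoc AX.r_neg)
    also have "\<dots> = h \<otimes>\<^bsub>?AX\<^esub> f" using f(1) hr(1) by (rule AX.m_comm)
    also have "\<dots> \<in> ?I" using hr(1) unfolding cgenideal_def by blast
    finally have "C = ?I +>\<^bsub>?AX\<^esub> r"
      unfolding g(2) using AX.quotient_eq_iff_same_a_r_cos[OF I g(1) hr(2)] by blast
    moreover have "r \<in> ?D" using hr(2,4) by auto
    ultimately show "C \<in> (\<lambda>r. ?I +>\<^bsub>?AX\<^esub> r) ` ?D" by blast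
  qed
  then have "card (carrier (?AX Quot ?I)) \<le> card ?D"
    using surj_card_le[OF card_bounded_polys(1)] by blast
  then show ?thesis unfolding card_bounded_polys(2) .
qed

end

section \<open>Maximal subrings with full residue field\<close>

lemma (in ring_hom_ring) hom_add_pow:
  fixes k :: nat
  assumes "x \<in> carrier R"
  shows "h (add_pow R k x) = add_pow S k (h x)"
  by (induction k) (use assms in auto)

lemma (in ring) carrier_FactRing: "carrier (R Quot I) = (+>) I ` carrier R"
  by (auto simp: FactRing_def A_RCOSETS_def')

lemma (in ring) zero_FactRing: "\<zero>\<^bsub>R Quot I\<^esub> = I"
  by (simp add: FactRing_def)

lemma (in ring) coset_eq_ideal_iff:
  assumes "ideal I R" "x \<in> carrier R"
  shows "I +> x = I \<longleftrightarrow> x \<in> I"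
proof -
  interpret I: ideal I R by fact
  show ?thesis using assms(2) I.a_rcos_const I.a_rcos_self by blast
qed

lemma (in abelian_group) minus_cancel:
  assumes "x \<in> carrier G" "y \<in> carrier G"
  shows "x \<oplus> (y \<ominus> x) = y" "y \<oplus> \<ominus> (y \<ominus> x) = x" "x \<ominus> y = \<ominus> (y \<ominus> x)" "(y \<ominus> x) \<oplus> x = y"
proof -
  show 4: "(y \<ominus> x) \<oplus> x = y" using assms by (simp add: a_minus_def a_assoc l_neg)
  show "x \<oplus> (y \<ominus> x) = y" using 4 assms a_comm[of x "y \<ominus> x"] by simp
  show 3: "x \<ominus> y = \<ominus> (y \<ominus> x)" using assms by (simp add: a_minus_def minus_add a_comm)
  have "y \<oplus> (x \<ominus> y) = (x \<ominus> y) \<oplus> y" using assms by (intro a_comm) auto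
  also have "\<dots> = x" using assms by (simp add: a_minus_def a_assoc l_neg)
  finally show "y \<oplus> \<ominus> (y \<ominus> x) = x" unfolding 3 .
qed

lemma (in cring) add_ideal_subring:
  assumes "subring S R" "ideal I R"
  shows "subring {s \<oplus> i | s i. s \<in> S \<and> i \<in> I} R"
proof -
  note S = subringE[OF assms(1)]
  interpret I: ideal I R by fact
  have Sc: "s \<in> carrier R" if "s \<in> S" for s using S(1) that by blast
  have Ic: "i \<in> carrier R" if "i \<in> I" for i using I.a_subset that by blast
  show ?thesis
  proof (rule subringI)
    show "{s \<oplus> i | s i. s \<in> S \<and> i \<in> I} \<subseteq> carrier R" using Sc Ic by auto
    show "\<one> \<in> {s \<oplus> i | s i. s \<in> S \<and> i \<in> I}"
    proof -
      have "\<one> = \<one> \<oplus> \<zero>" by simp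
      then show ?thesis using S(3) I.zero_closed by blast
    qed
  next
    fix h assume "h \<in> {s \<oplus> i | s i. s \<in> S \<and> i \<in> I}"
    then obtain s i where h: "h = s \<oplus> i" "s \<in> S" "i \<in> I" by blast
    then have "\<ominus> h = (\<ominus> s) \<oplus> (\<ominus> i)" using Sc Ic by (simp add: minus_add)
    then show "\<ominus> h \<in> {s \<oplus> i | s i. s \<in> S \<and> i \<in> I}" using h S(5) I.a_inv_closed by blast
  next
    fix h h' assume "h \<in> {s \<oplus> i | s i. s \<in> S \<and> i \<in> I}" "h' \<in> {s \<oplus> i | s i. s \<in> S \<and> i \<in> I}"
    then obtain s i s' i' where h: "h = s \<oplus> i" "s \<in> S" "i \<in> I" "h' = s' \<oplus> i'" "s' \<in> S" "i' \<in> I" by blast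
    note c = Sc[OF h(2)] Sc[OF h(5)] Ic[OF h(3)] Ic[OF h(6)]
    have "h \<otimes> h' = s \<otimes> s' \<oplus> (s \<otimes> i' \<oplus> h' \<otimes> i)" unfolding h(1,4) using c by algebra
    moreover have "s \<otimes> i' \<oplus> h' \<otimes> i \<in> I" using h(3,6) c I.I_l_closed unfolding h(4) by auto
    ultimately show "h \<otimes> h' \<in> {s \<oplus> i | s i. s \<in> S \<and> i \<in> I}" using h S(6) by blast
    have "h \<oplus> h' = (s \<oplus> s') \<oplus> (i \<oplus> i')" unfolding h(1,4) using c by algebra
    then show "h \<oplus> h' \<in> {s \<oplus> i | s i. s \<in> S \<and> i \<in> I}" using h S(7) I.a_closed by blast
  qed
qed

section \<open>The residue field and the ideal J\<close>

locale local_ring_prime = finite_local_ring +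
  fixes p n :: nat
  assumes prime_p: "Factorial_Ring.prime p" and q_eq: "q = p ^ n" and n_pos: "n > 0"
begin

lemma p_gt_1: "p > 1" using prime_p prime_gt_1_nat by blast

lemma q_gt_1: "q > 1" unfolding q_eq using one_less_power[OF p_gt_1 n_pos] .

sublocale k: field "R Quot m"
  by (rule m.quotient_is_field[OF is_cring])

sublocale \<pi>: ring_hom_ring R "R Quot m" "(+>) m"
  by (rule m.rcos_ring_hom_ring)

lemma finite_k: "finite (carrier (R Quot m))"
  using q_pos card_gt_0_iff by blast

abbreviation p1 :: 'a where "p1 \<equiv> add_pow R p \<one>"

lemma p1_in_m: "p1 \<in> m"
proof -
  have "m +> p1 = m"
    using \<pi>.hom_add_pow[of \<one> p] k.char_of_card[OF prime_p q_eq n_pos]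
    by (simp add: zero_FactRing)
  then show ?thesis using coset_eq_ideal_iff[OF m.ideal_axioms] by simp
qed

text \<open>This is J. The multiples of p are written as a set, rather than as
  \<open>PIdl p1\<close>, so that unfolding yields exactly the expression in the hypothesis on
  \<rho>.\<close>

definition base :: "'a set"
  where "base = ideal_prod R m m <+>\<^bsub>R\<^esub> {p1 \<otimes> y | y. y \<in> carrier R}"

lemma PIdl_p1: "{p1 \<otimes> y | y. y \<in> carrier R} = PIdl p1"
proof -
  have "p1 \<otimes> y = y \<otimes> p1" if "y \<in> carrier R" for y using that m_comm[of p1 y] by simp
  then show ?thesis unfolding cgenideal_def by (metis (no_types, lifting))
qed

lemma ideal_base: "ideal base R"
  unfolding base_def PIdl_p1
  by (intro add_ideals ideal_prod_is_ideal cgenideal_ideal m.ideal_axioms) simp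

text \<open>J is additively generated by these two families of products. H is only assumed to be an
  additive subgroup so that the criterion applies to subrings, which need not be ideals.\<close>

lemma base_subset_iff:
  assumes "additive_subgroup H R"
  shows "base \<subseteq> H \<longleftrightarrow> (\<forall>x\<in>m. \<forall>y\<in>m. x \<otimes> y \<in> H) \<and> (\<forall>y\<in>carrier R. p1 \<otimes> y \<in> H)"
proof
  interpret H: additive_subgroup H R by fact
  assume *: "(\<forall>x\<in>m. \<forall>y\<in>m. x \<otimes> y \<in> H) \<and> (\<forall>y\<in>carrier R. p1 \<otimes> y \<in> H)"
  have "x \<in> H" if "x \<in> ideal_prod R m m" for x
    using that by (induction rule: ideal_prod.induct) (use * in auto)
  then show "base \<subseteq> H" unfolding base_def set_add_def' using * by auto
next
  assume b: "base \<subseteq> H"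
  have "z \<in> base" if "z \<in> ideal_prod R m m" for z
  proof -
    have "z \<in> carrier R" using that ideal_prod_in_carrier[OF m.ideal_axioms m.ideal_axioms] by blast
    then have "z = z \<oplus> p1 \<otimes> \<zero>" by simp
    then show ?thesis unfolding base_def set_add_def' using that by blast
  qed
  moreover have "p1 \<otimes> y \<in> base" if "y \<in> carrier R" for y
  proof -
    have "\<zero> \<in> ideal_prod R m m"
      using ideal_prod_is_ideal[OF m.ideal_axioms m.ideal_axioms] 
      by (simp add: additive_subgroup.zero_closed ideal.axioms(1))
    moreover have "p1 \<otimes> y = \<zero> \<oplus> p1 \<otimes> y" using that by simp
    ultimately show ?thesis unfolding base_def set_add_def' using that by blast
  qed
  ultimately show "(\<forall>x\<in>m. \<forall>y\<in>m. x \<otimes> y \<in> H) \<and> (\<forall>y\<in>carrier R. p1 \<otimes> y \<in> H)"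
    using b ideal_prod.prod[of _ m _ m R] by (auto simp: subset_iff)
qed

lemma base_subset_m: "base \<subseteq> m"
  unfolding base_subset_iff[OF m.additive_subgroup_axioms]
  by (auto intro!: m.I_l_closed m.I_r_closed p1_in_m)

lemma mult_in_base: "x \<in> m \<Longrightarrow> y \<in> m \<Longrightarrow> x \<otimes> y \<in> base"
  using base_subset_iff[OF ideal.axioms(1)[OF ideal_base]] by simp

lemma p1_mult_in_base: "y \<in> carrier R \<Longrightarrow> p1 \<otimes> y \<in> base"
  using base_subset_iff[OF ideal.axioms(1)[OF ideal_base]] by simp

lemma p1_in_base: "p1 \<in> base"
  using p1_mult_in_base[of \<one>] by simp

text \<open>Rewrites a full residue field as R = S + m, elementwise. In this form m can be replaced
  by smaller ideals.\<close>

lemma proj_image_eq_carrier_iff: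
  assumes "S \<subseteq> carrier R"
  shows "(+>) m ` S = carrier (R Quot m) \<longleftrightarrow> (\<forall>x\<in>carrier R. \<exists>s\<in>S. x \<ominus> s \<in> m)"
proof -
  have "(+>) m ` S = carrier (R Quot m) \<longleftrightarrow> (\<forall>x\<in>carrier R. \<exists>s\<in>S. m +> x = m +> s)"
    unfolding carrier_FactRing using assms by (auto simp: image_iff subset_iff) blast
  also have "\<dots> \<longleftrightarrow> (\<forall>x\<in>carrier R. \<exists>s\<in>S. x \<ominus> s \<in> m)"
    by (intro ball_cong bex_cong refl quotient_eq_iff_same_a_r_cos[OF m.ideal_axioms, symmetric])
      (use assms in auto)
  finally show ?thesis .
qed

lemma base_subset_max_subring:
  assumes "max_subring R S" "\<forall>x\<in>carrier R. \<exists>s\<in>S. x \<ominus> s \<in> m"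
  shows "base \<subseteq> S"
proof -
  have S: "subring S R" "S \<noteq> carrier R" using assms(1) unfolding max_subring_def by auto
  note SE = subringE[OF S(1)]
  let ?A = "{I. ideal I R \<and> (\<forall>x\<in>carrier R. \<exists>s\<in>S. x \<ominus> s \<in> I)}"
  have "finite ?A" by (rule finite_subset[of _ "Pow (carrier R)"])
      (auto simp: finite_carrier dest: additive_subgroup.a_subset[OF ideal.axioms(1)])
  moreover have "m \<in> ?A" using assms(2) m.ideal_axioms by auto
  ultimately have "\<exists>I\<in>?A. I \<subseteq> m \<and> (\<forall>L\<in>?A. L \<subseteq> I \<longrightarrow> I = L)"
    by (rule finite_has_minimal2)
  then obtain I where I: "ideal I R" "\<And>x. x \<in> carrier R \<Longrightarrow> \<exists>s\<in>S. x \<ominus> s \<in> I" "I \<subseteq> m"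
    and min: "\<forall>L\<in>?A. L \<subseteq> I \<longrightarrow> I = L" by auto
  interpret I: ideal I R by (rule I(1))
  have dec: "\<exists>s\<in>S. \<exists>i\<in>I. x = s \<oplus> i" if x: "x \<in> carrier R" for x
  proof -
    obtain s where s: "s \<in> S" "x \<ominus> s \<in> I" using I(2)[OF x] by blast
    then have "s \<in> carrier R" using SE(1) by blast
    then have "x = s \<oplus> (x \<ominus> s)" using x by algebra
    then show ?thesis using s by blast
  qed
  have "I \<noteq> {\<zero>}"
  proof
    assume "I = {\<zero>}"
    then have "carrier R \<subseteq> S" using dec SE(1) by force
    then show False using S(2) SE(1) by blast
  qed
  then have "{\<zero>} \<subset> I" by auto
  then obtain K where K: "K \<in> maximal_subideals {\<zero>} I"
    using maximal_subideals_nonempty[OF zeroideal _ finite_ideal[OF I(1)]] by blast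
  then have Ki: "ideal K R" "K \<subset> I" unfolding maximal_subideals_def by auto
  interpret K: ideal K R by (rule Ki(1))
  have mI: "x \<otimes> y \<in> K" if "x \<in> m" "y \<in> I" for x y
    using maximal_subideal_mult[OF I(1) K] that by blast
  \<comment> \<open>The subring S + K is proper, since otherwise K would be a smaller member of
    \<open>?A\<close> than I. Maximality of S then gives S + K = S, that is, K \<subseteq>
    S.\<close>
  let ?T = "{s \<oplus> i | s i. s \<in> S \<and> i \<in> K}"
  have T: "subring ?T R" using add_ideal_subring[OF S(1) Ki(1)] .
  have ST: "S \<subseteq> ?T"
  proof
    fix s assume s: "s \<in> S"
    then have "s = s \<oplus> \<zero>" using SE(1) by auto
    then show "s \<in> ?T" using s K.zero_closed by blast
  qed
  have KT: "K \<subseteq> ?T"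
  proof
    fix i assume i: "i \<in> K"
    then have "i = \<zero> \<oplus> i" by simp
    then show "i \<in> ?T" using i SE(2) by blast
  qed
  have "?T \<noteq> carrier R"
  proof
    assume *: "?T = carrier R"
    have "\<exists>s\<in>S. x \<ominus> s \<in> K" if x: "x \<in> carrier R" for x
    proof -
      obtain s i where si: "s \<in> S" "i \<in> K" "x = s \<oplus> i" using * x by blast
      then have "s \<in> carrier R" "i \<in> carrier R" using SE(1) by auto
      then have "x \<ominus> s = i" unfolding si(3) by algebra
      then show ?thesis using si by blast
    qed
    then have "K \<in> ?A" using Ki(1) by blast
    then show False using min Ki(2) by blast
  qed
  then have "?T = S" using assms(1) T ST unfolding max_subring_def by blast
  then have KS: "K \<subseteq> S" using KT by simp
  have "x \<otimes> y \<in> S" if xy: "x \<in> m" "y \<in> m" for x y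
  proof -
    obtain s i where si: "s \<in> S" "i \<in> I" "x = s \<oplus> i" using dec xy m.a_subset by blast
    obtain t j where tj: "t \<in> S" "j \<in> I" "y = t \<oplus> j" using dec xy m.a_subset by blast
    have c: "s \<in> carrier R" "i \<in> carrier R" "t \<in> carrier R" "j \<in> carrier R"
      using si tj SE(1) by auto
    \<comment> \<open>As I \<subseteq> m, the S-part s of x lies in m. The mixed terms
      \<open>s \<otimes> j\<close> and \<open>y \<otimes> i\<close> are therefore in m I \<subseteq>
      K \<subseteq> S, and the remaining term \<open>s \<otimes> t\<close> is a product inside
      S.\<close>
    have "s = x \<oplus> \<ominus> i" using si(3) c by algebra
    then have "s \<in> m" using xy(1) si(2) I(3) by auto
    then have "s \<otimes> j \<in> K" "y \<otimes> i \<in> K" using mI si tj xy by auto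
    then have "s \<otimes> t \<in> S" "s \<otimes> j \<in> S" "y \<otimes> i \<in> S" using KS SE(6) si tj by auto
    moreover have "x \<otimes> y = s \<otimes> t \<oplus> (s \<otimes> j \<oplus> y \<otimes> i)" unfolding si(3) tj(3) using c by algebra
    ultimately show ?thesis using SE(7) by simp
  qed
  moreover have "p1 \<otimes> y \<in> S" if y: "y \<in> carrier R" for y
  proof -
    obtain s i where si: "s \<in> S" "i \<in> I" "y = s \<oplus> i" using dec y by blast
    have c: "s \<in> carrier R" "i \<in> carrier R" using si SE(1) by auto
    have "p1 \<in> S"
    proof -
      have "add_pow R k \<one> \<in> S" for k :: nat
        by (induction k) (use SE in auto)
      then show ?thesis .
    qed
    then have "p1 \<otimes> s \<in> S" "p1 \<otimes> i \<in> S" using SE(6) si mI[OF p1_in_m] KS by auto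
    moreover have "p1 \<otimes> y = p1 \<otimes> s \<oplus> p1 \<otimes> i" unfolding si(3) using c by (simp add: r_distr)
    ultimately show ?thesis using SE(7) by simp
  qed
  ultimately show ?thesis 
    using base_subset_iff[OF additive_subgroup_subring[OF S(1)]] by blast
qed

text \<open>For an ideal \<open>I\<close> between \<open>base\<close> and \<open>m\<close> this is the preimage of the unique copy of the
  residue field in \<open>R/I\<close>, cut out by the Frobenius power \<open>x \<mapsto> x^q\<close>, which is additive modulo \<open>p\<close>.\<close>
definition teich :: "'a set \<Rightarrow> 'a set"
  where "teich I = {x \<in> carrier R. x [^] q \<ominus> x \<in> I}"

context
  fixes I assumes I: "ideal I R" and base_I: "base \<subseteq> I"
begin

interpretation I: ideal I R by (rule I)

interpretation Q: cring "R Quot I" by (rule I.quotient_is_cring[OF is_cring])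

interpretation h: ring_hom_ring R "R Quot I" "(+>) I" by (rule I.rcos_ring_hom_ring)

lemma quot_char: "add_pow (R Quot I) p \<one>\<^bsub>R Quot I\<^esub> = \<zero>\<^bsub>R Quot I\<^esub>"
  using h.hom_add_pow[of \<one> p] coset_eq_ideal_iff[OF I, of p1] p1_in_base base_I
  by (auto simp: zero_FactRing)

lemma hom_pow: "x \<in> carrier R \<Longrightarrow> I +> (x [^] i) = (I +> x) [^]\<^bsub>R Quot I\<^esub> (i::nat)"
  by (rule h.hom_nat_pow)

lemma teich_eq: "teich I = {x \<in> carrier R. (I +> x) [^]\<^bsub>R Quot I\<^esub> q = I +> x}"
  unfolding teich_def
  using quotient_eq_iff_same_a_r_cos[OF I] by (auto simp: hom_pow)

lemma teich_subring: "subring (teich I) R"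
proof -
  have F: "subring {Y \<in> carrier (R Quot I). Y [^]\<^bsub>R Quot I\<^esub> q = Y} (R Quot I)"
    using Q.frobenius_fixed_subring[OF prime_p quot_char, of n] unfolding q_eq .
  have "teich I = {x \<in> carrier R. I +> x \<in> {Y \<in> carrier (R Quot I). Y [^]\<^bsub>R Quot I\<^esub> q = Y}}"
    unfolding teich_eq by auto
  also have "subring \<dots> R"
    by (rule subringI) (use subringE[OF F] in \<open>auto\<close>)
  finally show ?thesis .
qed

text \<open>Modulo I the q-th power is additive, and a^q vanishes there because q \<ge> 2 puts a
  factor from m m \<subseteq> J into it. So x^q modulo I depends only on the class of x modulo
  m.\<close>

lemma pow_q_add:
  assumes "x \<in> carrier R" "a \<in> m"
  shows "(x \<oplus> a) [^] q \<ominus> x [^] q \<in> I"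
proof -
  have a: "a \<in> carrier R" using assms(2) by simp
  define j where "j = q - 2"
  then have j: "q = Suc (Suc j)" using q_gt_1 by linarith
  have "a [^] q = a [^] j \<otimes> (a \<otimes> a)" unfolding j using a by (simp add: m_assoc)
  then have "a [^] q \<in> I" using mult_in_base[OF assms(2,2)] base_I I.I_l_closed a by auto
  then have z: "(I +> a) [^]\<^bsub>R Quot I\<^esub> q = \<zero>\<^bsub>R Quot I\<^esub>"
    using hom_pow[OF a, of q] coset_eq_ideal_iff[OF I, of "a [^] q"] a by (simp add: zero_FactRing)
  have c: "I +> x \<in> carrier (R Quot I)" "I +> a \<in> carrier (R Quot I)" using assms(1) a h.hom_closed by blast+
  have "I +> ((x \<oplus> a) [^] q) = ((I +> x) \<oplus>\<^bsub>R Quot I\<^esub> (I +> a)) [^]\<^bsub>R Quot I\<^esub> q"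
    using hom_pow[of "x \<oplus> a" q] h.hom_add[OF assms(1) a] assms(1) a by (simp only: a_closed)
  also have "\<dots> = (I +> x) [^]\<^bsub>R Quot I\<^esub> q \<oplus>\<^bsub>R Quot I\<^esub> (I +> a) [^]\<^bsub>R Quot I\<^esub> q"
    using Q.frobenius_pow_add[OF prime_p quot_char c, of n] unfolding q_eq[symmetric] .
  also have "\<dots> = (I +> x) [^]\<^bsub>R Quot I\<^esub> q"
    unfolding z by (rule Q.r_zero[OF Q.nat_pow_closed[OF c(1)]])
  also have "\<dots> = I +> (x [^] q)"
    by (rule hom_pow[OF assms(1), symmetric])
  finally show ?thesis
    using quotient_eq_iff_same_a_r_cos[OF I, of "(x \<oplus> a) [^] q" "x [^] q"] assms(1) a by blast
qed

end

lemma pow_q_diff_in_m: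
  assumes "x \<in> carrier R"
  shows "x [^] q \<ominus> x \<in> m"
proof -
  have "m +> x \<in> k.frob_fixed p n"
    using k.frob_fixed_n[OF prime_p q_eq n_pos] assms by auto
  then have "(m +> x) [^]\<^bsub>R Quot m\<^esub> q = m +> x"
    unfolding k.frob_fixed_def[OF prime_p q_eq n_pos] q_eq by simp
  then have "m +> (x [^] q) = m +> x" using assms by (simp add: \<pi>.hom_nat_pow)
  then show ?thesis using quotient_eq_iff_same_a_r_cos[OF m.ideal_axioms] assms by simp
qed

lemma teich_m: "teich m = carrier R"
  unfolding teich_def using pow_q_diff_in_m by blast

lemma teich_mono: "I \<subseteq> I' \<Longrightarrow> teich I \<subseteq> teich I'"
  unfolding teich_def by blast

text \<open>On m the q-th power already lies in I, so x^q - x is in I exactly when x is.\<close>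

lemma teich_Int_m:
  assumes "ideal I R" "base \<subseteq> I" "I \<subseteq> m"
  shows "teich I \<inter> m = I"
proof -
  interpret I: ideal I R by fact
  have "x [^] q \<in> I" if "x \<in> m" for x
  proof -
    have "(\<zero> \<oplus> x) [^] q \<ominus> \<zero> [^] q \<in> I" using pow_q_add[OF assms(1,2) _ that] by blast
    then show ?thesis using that q_gt_1 by (simp add: nat_pow_zero a_minus_def)
  qed
  then have *: "x [^] q \<ominus> x \<in> I \<longleftrightarrow> x \<in> I" if "x \<in> m" for x
  proof -
    have x: "x \<in> carrier R" "x [^] q \<in> I" using that \<open>\<And>x. x \<in> m \<Longrightarrow> x [^] q \<in> I\<close> by auto
    have "x = x [^] q \<oplus> \<ominus> (x [^] q \<ominus> x)" using x(1) minus_cancel(2) by simp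
    moreover have "x [^] q \<ominus> x \<in> I" if "x \<in> I" using that x(2) by (simp add: a_minus_def)
    moreover have "x \<in> I" if "x [^] q \<ominus> x \<in> I"
      using I.a_closed[OF x(2) I.a_inv_closed[OF that]] minus_cancel(2)[of x "x [^] q"] x(1) by simp
    ultimately show ?thesis by blast
  qed
  then show ?thesis unfolding teich_def using assms(3) m.a_subset by blast
qed

text \<open>The witness is x^q = x + a with a in m: its q-th power (x + a)^q is congruent to x^q
  modulo I.\<close>

lemma teich_surj:
  assumes "ideal I R" "base \<subseteq> I" "x \<in> carrier R"
  shows "\<exists>s\<in>teich I. x \<ominus> s \<in> m"
proof
  let ?a = "x [^] q \<ominus> x"
  have a: "?a \<in> m" by (rule pow_q_diff_in_m[OF assms(3)])
  have "x \<oplus> ?a = x [^] q" using assms(3) minus_cancel(1) by simp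
  then show "x [^] q \<in> teich I"
    unfolding teich_def using pow_q_add[OF assms(1,2,3) a] assms(3) by simp
  have "x \<ominus> x [^] q = \<ominus> ?a" using minus_cancel(3)[OF assms(3), of "x [^] q"] assms(3) by blast
  then show "x \<ominus> x [^] q \<in> m" using a by simp
qed

text \<open>S \<inter> m absorbs r because r a = (r - s) a + s a, where s in S is congruent to r
  modulo m and (r - s) a is in m m \<subseteq> J \<subseteq> S. For the harder inclusion, x in
  \<open>teich (S \<inter> m)\<close> differs from some s in S by an element of
  \<open>teich (S \<inter> m)\<close> and m, which lies in S \<inter> m.\<close>

lemma subring_eq_teich:
  assumes S: "subring S R" "base \<subseteq> S" and surj: "\<forall>x\<in>carrier R. \<exists>s\<in>S. x \<ominus> s \<in> m"
  shows "ideal (S \<inter> m) R" "S = teich (S \<inter> m)"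
proof -
  note SE = subringE[OF S(1)]
  show id: "ideal (S \<inter> m) R"
  proof (rule idealI)
    show "subgroup (S \<inter> m) (add_monoid R)"
      by (rule add.subgroupI) (use SE in auto)
    fix a r assume a: "a \<in> S \<inter> m" and r: "r \<in> carrier R"
    obtain s where s: "s \<in> S" "r \<ominus> s \<in> m" using surj r by blast
    have c: "s \<in> carrier R" "a \<in> carrier R" using s SE(1) a by auto
    have "(r \<ominus> s) \<otimes> a \<in> S" using mult_in_base[OF s(2)] a S(2) by blast
    moreover have "s \<otimes> a \<in> S" using s a SE(6) by blast
    moreover have "r \<otimes> a = (r \<ominus> s) \<otimes> a \<oplus> s \<otimes> a" using c r by algebra
    ultimately have "r \<otimes> a \<in> S" using SE(7) by metis
    then show "r \<otimes> a \<in> S \<inter> m" "a \<otimes> r \<in> S \<inter> m" using a r m.I_l_closed m_comm[OF c(2) r] by auto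
  qed (rule ring_axioms)
  have b: "base \<subseteq> S \<inter> m" using S base_subset_m by blast
  have sub: "S \<subseteq> teich (S \<inter> m)"
  proof
    fix x assume x: "x \<in> S"
    then have xc: "x \<in> carrier R" using SE(1) by blast
    have "x [^] i \<in> S" for i :: nat by (induction i) (use x SE in auto)
    then have "x [^] q \<ominus> x \<in> S" using x SE(5,7) by (simp add: a_minus_def)
    then show "x \<in> teich (S \<inter> m)" unfolding teich_def using xc pow_q_diff_in_m by blast
  qed
  have "teich (S \<inter> m) \<subseteq> S"
  proof
    fix x assume x: "x \<in> teich (S \<inter> m)"
    then have xc: "x \<in> carrier R" unfolding teich_def by blast
    obtain s where s: "s \<in> S" "x \<ominus> s \<in> m" using surj xc by blast
    have sc: "s \<in> carrier R" using s SE(1) by blast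
    note T = subringE[OF teich_subring[OF id b]]
    have "x \<ominus> s \<in> teich (S \<inter> m)" using x s(1) sub T(5,7) by (auto simp: a_minus_def)
    then have "x \<ominus> s \<in> S" using s(2) teich_Int_m[OF id b] by blast
    moreover have "x = (x \<ominus> s) \<oplus> s" using xc sc by algebra
    ultimately show "x \<in> S" using SE(7) s(1) by metis
  qed
  with sub show "S = teich (S \<inter> m)" by blast
qed

section \<open>Maximal subrings of kind (i) as hyperplanes of m/J\<close>

definition unramified_max_subrings :: "'a set set"
  where "unramified_max_subrings = {S. max_subring R S \<and> res_field R m S = carrier (R Quot m)}"

lemma res_field_eq: "res_field R m S = (+>) m ` S"
  unfolding res_field_def proj_def by (rule refl)

text \<open>For the last claim, \<open>teich\<close> is monotone and \<open>teich L\<close> meets m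
  in L: an ideal L with S \<inter> m \<subset> L \<subset> m would give a proper subring strictly
  above S.\<close>

lemma unramified_max_subringsD:
  assumes "S \<in> unramified_max_subrings"
  shows "subring S R" "S \<noteq> carrier R" "base \<subseteq> S" "\<forall>x\<in>carrier R. \<exists>s\<in>S. x \<ominus> s \<in> m"
    "ideal (S \<inter> m) R" "S = teich (S \<inter> m)" "S \<inter> m \<in> maximal_subideals base m"
proof -
  have S: "max_subring R S" "(+>) m ` S = carrier (R Quot m)" 
    using assms unfolding unramified_max_subrings_def res_field_eq by auto
  then show 1: "subring S R" "S \<noteq> carrier R" unfolding max_subring_def by auto
  show 2: "\<forall>x\<in>carrier R. \<exists>s\<in>S. x \<ominus> s \<in> m"
    using proj_image_eq_carrier_iff[OF subringE(1)[OF 1(1)]] S(2) by blast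
  show 3: "base \<subseteq> S" by (rule base_subset_max_subring[OF S(1) 2])
  show 4: "ideal (S \<inter> m) R" "S = teich (S \<inter> m)" using subring_eq_teich[OF 1(1) 3 2] by auto
  have "S \<inter> m \<noteq> m" using 4(2) 1(2) teich_m by metis
  moreover have "L = S \<inter> m" if L: "ideal L R" "S \<inter> m \<subseteq> L" "L \<subset> m" for L
  proof -
    have bL: "base \<subseteq> L" using L(2) 3 base_subset_m by blast
    have Lm: "teich L \<inter> m = L" using teich_Int_m[OF L(1) bL] L(3) by blast
    then have "teich L \<noteq> carrier R" using L(3) m.a_subset by blast
    moreover have "S \<subseteq> teich L" using teich_mono[OF L(2)] 4(2) by blast
    ultimately have "teich L = S" using S(1) teich_subring[OF L(1) bL] unfolding max_subring_def by blast
    then show ?thesis using Lm by blast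
  qed
  ultimately show "S \<inter> m \<in> maximal_subideals base m"
    unfolding maximal_subideals_def using 4(1) 3 base_subset_m by blast
qed

text \<open>A subring T above \<open>teich I\<close> inherits both J \<subseteq> T and the full
  residue field, so it is \<open>teich (T \<inter> m)\<close>. Maximality of I leaves only T
  \<inter> m = I or T \<inter> m = m, and the latter gives all of R.\<close>

lemma teich_unramified_max_subring:
  assumes "I \<in> maximal_subideals base m"
  shows "teich I \<in> unramified_max_subrings" "teich I \<inter> m = I"
proof -
  have I: "ideal I R" "base \<subseteq> I" "I \<subset> m" "\<And>L. ideal L R \<Longrightarrow> I \<subseteq> L \<Longrightarrow> L \<subset> m \<Longrightarrow> L = I"
    using assms unfolding maximal_subideals_def by auto
  show Im: "teich I \<inter> m = I" using teich_Int_m[OF I(1,2)] I(3) by blast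
  have surj: "\<forall>x\<in>carrier R. \<exists>s\<in>teich I. x \<ominus> s \<in> m" using teich_surj[OF I(1,2)] by blast
  have sub: "subring (teich I) R" by (rule teich_subring[OF I(1,2)])
  have "T = teich I" if T: "subring T R" "teich I \<subseteq> T" "T \<noteq> carrier R" for T
  proof -
    have bT: "base \<subseteq> T" using I(2) Im T(2) by blast
    have sT: "\<forall>x\<in>carrier R. \<exists>s\<in>T. x \<ominus> s \<in> m" using surj T(2) by blast
    note eq = subring_eq_teich[OF T(1) bT sT]
    have "T \<inter> m \<noteq> m" using eq(2) T(3) teich_m by metis
    then have "T \<inter> m = I" using I(4)[OF eq(1)] Im T(2) by blast
    then show ?thesis using eq(2) by simp
  qed
  moreover have "teich I \<noteq> carrier R" using Im I(3) m.a_subset by blast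
  ultimately have "max_subring R (teich I)" unfolding max_subring_def using sub by blast
  moreover have "(+>) m ` teich I = carrier (R Quot m)"
    using proj_image_eq_carrier_iff[OF subringE(1)[OF sub]] surj by blast
  ultimately show "teich I \<in> unramified_max_subrings" 
    unfolding unramified_max_subrings_def res_field_eq by blast
qed

lemma card_unramified_max_subrings:
  assumes "card m = q ^ r * card base"
  shows "card unramified_max_subrings = (q ^ r - 1) div (q - 1)"
proof -
  have "bij_betw teich (maximal_subideals base m) unramified_max_subrings"
    by (rule bij_betwI[where g = "\<lambda>S. S \<inter> m"])
      (use teich_unramified_max_subring unramified_max_subringsD(6,7) in auto)
  then have c: "card unramified_max_subrings = card (maximal_subideals base m)"
    using bij_betw_same_card by metis
  have "card (maximal_subideals base m) * (q - 1) = q ^ r - 1"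
    by (rule card_maximal_subideals) (use ideal_base base_subset_m mult_in_base assms q_gt_1 in auto)
  then show ?thesis unfolding c using q_gt_1 by (metis nonzero_mult_div_cancel_right not_less_eq zero_less_diff zero_order(3))
qed

text \<open>S and m have the same size, namely q times that of S \<inter> m: S because it maps onto
  the residue field, m because S \<inter> m is a hyperplane. So S has the same index as m.\<close>

lemma index_unramified_max_subring:
  assumes "S \<in> unramified_max_subrings"
  shows "add_index R S = q"
proof -
  note S = unramified_max_subringsD[OF assms]
  have add: "additive_subgroup S R" by (rule additive_subgroup_subring[OF S(1)])
  have "(+>) m ` S = carrier (R Quot m)"
    using proj_image_eq_carrier_iff[OF subringE(1)[OF S(1)]] S(4) by blast
  then have "card S = q * card (S \<inter> m)"
    using card_image_cosets_restrict[OF m.additive_subgroup_axioms add finite_carrier]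
    by (simp add: Int_commute)
  moreover have "card m = q * card (S \<inter> m)"
    by (rule card_maximal_subideal[OF m.ideal_axioms S(7)])
  ultimately have "add_index R S * card m = q * card m"
    using a_lagrange[OF finite_carrier add] card_carrier by (simp add: add_index_def order_def)
  then show ?thesis using card_m_nonzero mult_right_cancel by blast
qed

end

section \<open>Maximal subrings with smaller residue field\<close>

context local_ring_prime
begin

abbreviation res_pre :: "'a set set \<Rightarrow> 'a set"
  where "res_pre F \<equiv> {x \<in> carrier R. proj R m x \<in> F}"

lemma res_pre_subring:
  assumes "subring F (R Quot m)"
  shows "subring (res_pre F) R"
  by (rule subringI) (use subringE[OF assms] in \<open>auto simp: proj_def\<close>)

lemma res_field_subfield:
  assumes "subring S R"
  shows "subfield (res_field R m S) (R Quot m)"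
  unfolding res_field_eq
  by (rule k.finite_subring_is_subfield[OF finite_k \<pi>.img_is_subring[OF assms]])

lemma res_field_res_pre:
  assumes "F \<subseteq> carrier (R Quot m)"
  shows "res_field R m (res_pre F) = F"
  using assms unfolding res_field_eq proj_def carrier_FactRing by auto

lemma m_subset_res_pre:
  assumes "subring F (R Quot m)"
  shows "m \<subseteq> res_pre F"
proof
  fix x assume "x \<in> m"
  then show "x \<in> res_pre F"
    using coset_eq_ideal_iff[OF m.ideal_axioms, of x] subringE(2)[OF assms]
    by (simp add: proj_def zero_FactRing)
qed

lemma subring_eq_carrier:
  assumes "subring T R" "m \<subseteq> T" "res_field R m T = carrier (R Quot m)"
  shows "T = carrier R"
proof
  note TE = subringE[OF assms(1)]
  show "T \<subseteq> carrier R" by (rule TE(1))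
  show "carrier R \<subseteq> T"
  proof
    fix x assume x: "x \<in> carrier R"
    then obtain s where s: "s \<in> T" "x \<ominus> s \<in> m"
      using assms(3) proj_image_eq_carrier_iff[OF TE(1)] unfolding res_field_eq by blast
    then have "(x \<ominus> s) \<oplus> s \<in> T" using TE(7) assms(2) by blast
    then show "x \<in> T" using minus_cancel(4)[of s x] x s(1) TE(1) by auto
  qed
qed

text \<open>The preimage of any proper subfield E above the residue field of S is a proper subring
  above S, hence equal to S. Taking E to be the residue field gives the second claim; arbitrary E
  gives the first, since E is recovered from its preimage.\<close>

lemma max_subring_res_field:
  assumes "max_subring R S" "res_field R m S \<noteq> carrier (R Quot m)"
  shows "max_subfield (R Quot m) (res_field R m S)" "S = res_pre (res_field R m S)"
proof -
  have S: "subring S R" and max: "\<And>T. subring T R \<Longrightarrow> S \<subseteq> T \<Longrightarrow> T \<noteq> carrier R \<Longrightarrow> T = S"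
    using assms(1) unfolding max_subring_def by auto
  have F: "subfield (res_field R m S) (R Quot m)" by (rule res_field_subfield[OF S])
  have pre: "S = res_pre E" if E: "subfield E (R Quot m)" "res_field R m S \<subseteq> E" "E \<noteq> carrier (R Quot m)" for E
  proof -
    have sub: "subring (res_pre E) R" by (rule res_pre_subring[OF subfieldE(1)[OF E(1)]])
    have "S \<subseteq> res_pre E" using E(2) subringE(1)[OF S] unfolding res_field_def by auto
    moreover have "res_pre E \<noteq> carrier R"
    proof
      assume *: "res_pre E = carrier R"
      have "res_field R m (res_pre E) = E" by (rule res_field_res_pre[OF subfieldE(3)[OF E(1)]])
      then have "E = carrier (R Quot m)"
        unfolding * res_field_eq carrier_FactRing by simp
      then show False using E(3) by simp
    qed
    ultimately show ?thesis using max[OF sub] by simp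
  qed
  show "S = res_pre (res_field R m S)" by (rule pre[OF F order_refl assms(2)])
  have "E = res_field R m S" if "subfield E (R Quot m)" "res_field R m S \<subseteq> E" "E \<noteq> carrier (R Quot m)" for E
    using pre[OF that] res_field_res_pre[OF subfieldE(3)[OF that(1)]] by simp
  then show "max_subfield (R Quot m) (res_field R m S)"
    unfolding max_subfield_def using F assms(2) by blast
qed

text \<open>A subring above the preimage contains m, so it is all of R once its residue field is
  full. Otherwise maximality of F fixes its residue field, and it lies in the preimage.\<close>

lemma res_pre_max_subring:
  assumes "max_subfield (R Quot m) F"
  shows "max_subring R (res_pre F)" "res_field R m (res_pre F) = F"
proof -
  have F: "subfield F (R Quot m)" "F \<noteq> carrier (R Quot m)"
    and max: "\<And>E. subfield E (R Quot m) \<Longrightarrow> F \<subseteq> E \<Longrightarrow> E \<noteq> carrier (R Quot m) \<Longrightarrow> E = F"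
    using assms unfolding max_subfield_def by auto
  have sub: "subring (res_pre F) R" by (rule res_pre_subring[OF subfieldE(1)[OF F(1)]])
  show rf: "res_field R m (res_pre F) = F" by (rule res_field_res_pre[OF subfieldE(3)[OF F(1)]])
  have "res_pre F \<noteq> carrier R"
    using rf F(2) unfolding res_field_eq carrier_FactRing by auto
  moreover have "T = res_pre F" if T: "subring T R" "res_pre F \<subseteq> T" "T \<noteq> carrier R" for T
  proof -
    have "m \<subseteq> T" using m_subset_res_pre[OF subfieldE(1)[OF F(1)]] T(2) by blast
    then have "res_field R m T \<noteq> carrier (R Quot m)" using subring_eq_carrier T by blast
    moreover have "F \<subseteq> res_field R m T" using T(2) rf unfolding res_field_def by blast
    ultimately have "res_field R m T = F" using max[OF res_field_subfield[OF T(1)]] by simp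
    then have "T \<subseteq> res_pre F" using subringE(1)[OF T(1)] unfolding res_field_def by auto
    then show ?thesis using T(2) by blast
  qed
  ultimately show "max_subring R (res_pre F)" unfolding max_subring_def using sub by blast
qed

lemma max_subrings_over_max_subfield:
  assumes "max_subfield (R Quot m) F"
  shows "{S. max_subring R S \<and> res_field R m S = F} = {res_pre F}"
proof (intro subset_antisym subsetI)
  fix S assume "S \<in> {S. max_subring R S \<and> res_field R m S = F}"
  moreover have "F \<noteq> carrier (R Quot m)" using assms unfolding max_subfield_def by simp
  ultimately show "S \<in> {res_pre F}" using max_subring_res_field(2)[of S] by auto
qed (use res_pre_max_subring[OF assms] in auto)

text \<open>The preimage consists of \<open>card F\<close> cosets of m and R of q cosets; Lagrange
  in R and in R/m then gives the same index after cancelling.\<close>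

lemma index_res_pre:
  assumes "subfield F (R Quot m)"
  shows "add_index R (res_pre F) = add_index (R Quot m) F"
proof -
  have F: "subring F (R Quot m)" by (rule subfieldE(1)[OF assms])
  have add: "additive_subgroup (res_pre F) R" by (rule additive_subgroup_subring[OF res_pre_subring[OF F]])
  have finF: "finite F" using finite_k subfieldE(3)[OF assms] finite_subset by blast
  have "card F > 0" using finF subringE(4)[OF F] card_gt_0_iff by blast
  have "m \<inter> res_pre F = m" using m_subset_res_pre[OF F] by blast
  moreover have "(+>) m ` res_pre F = F"
    using res_field_res_pre[OF subfieldE(3)[OF assms]] unfolding res_field_eq .
  ultimately have c: "card (res_pre F) = card F * card m"
    using card_image_cosets_restrict[OF m.additive_subgroup_axioms add finite_carrier] by simp
  have 1: "add_index R (res_pre F) * card (res_pre F) = card (carrier R)"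
    using a_lagrange[OF finite_carrier add] by (simp add: add_index_def order_def)
  have 2: "add_index (R Quot m) F * card F = q"
    using k.a_lagrange[OF finite_k k.additive_subgroup_subring[OF F]] by (simp add: add_index_def order_def)
  have "(add_index R (res_pre F) * card F) * card m = (add_index (R Quot m) F * card F) * card m"
    using 1 unfolding 2 c card_carrier by (simp only: mult.assoc)
  then have "add_index R (res_pre F) * card F = add_index (R Quot m) F * card F"
    using card_m_nonzero mult_right_cancel by blast
  moreover have "card F \<noteq> 0" using \<open>card F > 0\<close> by linarith
  ultimately show ?thesis using mult_right_cancel by blast
qed

lemma card_max_subrings_max_subfield:
  "card {S. max_subring R S \<and> max_subfield (R Quot m) (res_field R m S)} = card (prime_factors n)"
proof -
  have "bij_betw res_pre {F. max_subfield (R Quot m) F}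
    {S. max_subring R S \<and> max_subfield (R Quot m) (res_field R m S)}"
  proof (rule bij_betwI[where g = "res_field R m"])
    show "res_field R m \<in> {S. max_subring R S \<and> max_subfield (R Quot m) (res_field R m S)} \<rightarrow>
      {F. max_subfield (R Quot m) F}" by auto
    show "res_pre \<in> {F. max_subfield (R Quot m) F} \<rightarrow>
      {S. max_subring R S \<and> max_subfield (R Quot m) (res_field R m S)}"
      using res_pre_max_subring by auto
    show "res_field R m (res_pre F) = F" if "F \<in> {F. max_subfield (R Quot m) F}" for F
      using that res_pre_max_subring(2) by blast
    show "res_pre (res_field R m S) = S"
      if "S \<in> {S. max_subring R S \<and> max_subfield (R Quot m) (res_field R m S)}" for S
    proof -
      have "max_subring R S" "res_field R m S \<noteq> carrier (R Quot m)"
        using that unfolding max_subfield_def by auto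
      then show ?thesis using max_subring_res_field(2)[of S] by simp
    qed
  qed
  from bij_betw_same_card[OF this] show ?thesis
    using k.card_max_subfields[OF prime_p q_eq n_pos] by (simp only:)
qed

end

section \<open>Galois rings\<close>

lemma (in ring_hom_ring) hom_add_pow_int:
  fixes c :: int
  assumes "x \<in> carrier R"
  shows "h (add_pow R c x) = add_pow S c (h x)"
proof (cases "c \<ge> 0")
  case True
  then show ?thesis using hom_add_pow[OF assms] by (simp add: add_pow_int_ge)
next
  case False
  have "h (\<ominus> (add_pow R (nat (- c)) x)) = \<ominus>\<^bsub>S\<^esub> h (add_pow R (nat (- c)) x)"
    using assms by (intro hom_a_inv) simp
  then show ?thesis using False hom_add_pow[OF assms, of "nat (- c)"]
    by (simp add: add_pow_int_lt)
qed

lemma (in ring_hom_ring) hom_int_eval: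
  assumes "x \<in> carrier R"
  shows "h (int_eval R x g) = int_eval S (h x) g"
proof -
  have "set (map (\<lambda>c. add_pow R (c::int) \<one>) g) \<subseteq> carrier R" by auto
  then have "h (int_eval R x g) = S.eval (map h (map (\<lambda>c. add_pow R (c::int) \<one>) g)) (h x)"
    unfolding int_eval_def by (rule eval_hom'[OF assms])
  also have "map h (map (\<lambda>c. add_pow R (c::int) \<one>) g) = map (\<lambda>c. add_pow S c \<one>\<^bsub>S\<^esub>) g"
    by (simp add: hom_add_pow_int)
  finally show ?thesis unfolding int_eval_def .
qed

lemma (in ring) int_eval_Nil: "int_eval R x [] = \<zero>"
  by (simp add: int_eval_def)

lemma (in ring) int_eval_Cons:
  "int_eval R x (c # g) = add_pow R c \<one> \<otimes> x [^] length g \<oplus> int_eval R x g"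
  by (simp add: int_eval_def)

lemma (in ring) int_eval_in_carrier: "x \<in> carrier R \<Longrightarrow> int_eval R x g \<in> carrier R"
  unfolding int_eval_def by (rule eval_in_carrier) auto

lemma (in cring) int_eval_zeros:
  "x \<in> carrier R \<Longrightarrow> int_eval R x (replicate k 0 @ g) = int_eval R x g"
  by (induction k) (simp_all add: int_eval_Cons int_eval_in_carrier add_pow_int_ge[of 0])

lemma (in cring) int_eval_uminus:
  assumes "x \<in> carrier R"
  shows "int_eval R x (map uminus g) = \<ominus> int_eval R x g"
proof (induction g)
  case (Cons c g)
  have "add_pow R (- c) \<one> = \<ominus> add_pow R c \<one>"
    by (rule add.int_pow_neg) simp
  then show ?case using Cons assms int_eval_in_carrier
    by (simp add: int_eval_Cons l_minus minus_add)
qed (simp add: int_eval_Nil)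

section \<open>The chain of ideals p^i R\<close>

context local_ring_prime
begin

abbreviation pp :: "nat \<Rightarrow> 'a" where "pp i \<equiv> add_pow R (p ^ i) \<one>"

lemma pp_Suc: "pp (Suc i) = p1 \<otimes> pp i"
proof -
  have "p1 \<otimes> pp i = add_pow R p (pp i)" using add_pow_ldistr[of \<one> "pp i" p] by simp
  also have "\<dots> = add_pow R (p ^ i * p) \<one>" by (rule add.nat_pow_pow) simp
  finally show ?thesis by (simp add: mult.commute)
qed

lemma PIdl_pp_0: "PIdl (pp 0) = carrier R"
  unfolding cgenideal_def by force

lemma ideal_PIdl_pp: "ideal (PIdl (pp i)) R"
  by (rule cgenideal_ideal) simp

lemma adjoin_PIdl_pp: "adjoin (PIdl (pp (Suc i))) (pp i) = PIdl (pp i)"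
proof
  have "pp (Suc i) \<in> PIdl (pp i)" unfolding pp_Suc cgenideal_def by auto
  then show "adjoin (PIdl (pp (Suc i))) (pp i) \<subseteq> PIdl (pp i)"
    by (intro adjoin_minimal ideal_PIdl_pp cgenideal_minimal cgenideal_self) auto
  show "PIdl (pp i) \<subseteq> adjoin (PIdl (pp (Suc i))) (pp i)"
    by (intro cgenideal_minimal ideal_adjoin ideal_PIdl_pp subset_adjoin) auto
qed

text \<open>From p^i = r p^(i+1) follows (1 - r p) p^i = 0. As p^i is nonzero, its annihilator lies
  in m, but 1 - r p does not. So the chain drops strictly until it reaches zero.\<close>

lemma pp_notin_PIdl_Suc:
  assumes "pp i \<noteq> \<zero>"
  shows "pp i \<notin> PIdl (pp (Suc i))"
proof
  assume "pp i \<in> PIdl (pp (Suc i))"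
  then obtain r where r: "r \<in> carrier R" "pp i = r \<otimes> (p1 \<otimes> pp i)"
    unfolding cgenideal_def pp_Suc by blast
  have p: "pp i \<in> carrier R" by simp
  have "(\<one> \<ominus> r \<otimes> p1) \<otimes> pp i = pp i \<ominus> r \<otimes> (p1 \<otimes> pp i)"
    using r(1) p by (simp add: a_minus_def l_distr l_minus m_assoc)
  also have "\<dots> = pp i \<ominus> pp i" using r(2) by simp
  also have "\<dots> = \<zero>" by (simp add: a_minus_def r_neg)
  finally have "\<one> \<ominus> r \<otimes> p1 \<in> {x \<in> carrier R. x \<otimes> pp i \<in> {\<zero>}}" using r(1) by simp
  then have "\<one> \<ominus> r \<otimes> p1 \<in> m" using colon_subset[OF zeroideal p] assms by blast
  then show False using one_minus_notin_m[OF p1_in_m r(1)] by simp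
qed

lemma card_PIdl_pp_ge:
  assumes "pp i \<noteq> \<zero>"
  shows "q * card (PIdl (pp (Suc i))) \<le> card (PIdl (pp i))"
  using card_adjoin_ge[OF ideal_PIdl_pp _ pp_notin_PIdl_Suc[OF assms]] adjoin_PIdl_pp[of i] by simp

text \<open>If m = pR then m p^i \<subseteq> p^(i+1) R, so the quotient is a one-dimensional space
  over the residue field.\<close>

lemma card_PIdl_pp_eq:
  assumes "pp i \<noteq> \<zero>" "m = PIdl p1"
  shows "card (PIdl (pp i)) = q * card (PIdl (pp (Suc i)))"
proof -
  have "x \<otimes> pp i \<in> PIdl (pp (Suc i))" if x: "x \<in> m" for x
  proof -
    obtain r where r: "r \<in> carrier R" "x = r \<otimes> p1" using x assms(2) unfolding cgenideal_def by blast
    then have "x \<otimes> pp i = r \<otimes> pp (Suc i)" unfolding pp_Suc by (simp add: m_assoc)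
    then show ?thesis unfolding cgenideal_def using r(1) by blast
  qed
  then show ?thesis
    using card_adjoin_eq[OF ideal_PIdl_pp _ pp_notin_PIdl_Suc[OF assms(1)]] adjoin_PIdl_pp[of i] by simp
qed

text \<open>If pR were smaller than m, an ideal K just below m and above pR would also contain m m
  by Nakayama, hence J; so J could not be m.\<close>

lemma base_eq_m_iff: "base = m \<longleftrightarrow> m = PIdl p1"
proof
  have p1: "p1 \<in> carrier R" by simp
  have sub: "PIdl p1 \<subseteq> m" by (rule cgenideal_minimal[OF m.ideal_axioms p1_in_m])
  assume b: "base = m"
  show "m = PIdl p1"
  proof (rule ccontr)
    assume "m \<noteq> PIdl p1"
    then have "PIdl p1 \<subset> m" using sub by blast
    then obtain K where K: "K \<in> maximal_subideals (PIdl p1) m"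
      using maximal_subideals_nonempty[OF cgenideal_ideal[OF p1] _ finite_m] by blast
    then have Ki: "ideal K R" "PIdl p1 \<subseteq> K" "K \<subset> m" unfolding maximal_subideals_def by auto
    have "x \<otimes> y \<in> K" if "x \<in> m" "y \<in> m" for x y
      using maximal_subideal_mult[OF m.ideal_axioms K] that by blast
    moreover have "p1 \<otimes> y \<in> K" if "y \<in> carrier R" for y
      using ideal.I_r_closed[OF Ki(1) _ that] Ki(2) cgenideal_self[OF p1] by blast
    ultimately have "base \<subseteq> K" using base_subset_iff[OF ideal.axioms(1)[OF Ki(1)]] by simp
    then show False using b Ki(3) by blast
  qed
next
  assume "m = PIdl p1"
  then have "m \<subseteq> base" using cgenideal_minimal[OF ideal_base p1_in_base] by simp
  then show "base = m" using base_subset_m by blast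
qed

context
  fixes N :: nat
  assumes pp_N: "pp N = \<zero>" and pp_nonzero: "\<And>i. i < N \<Longrightarrow> pp i \<noteq> \<zero>"
begin

lemma N_pos: "N > 0"
proof (rule gr0I)
  assume "N = 0"
  then have "\<one> = \<zero>" using pp_N by simp
  then show False using one_notin_m m.zero_closed by simp
qed

lemma PIdl_pp_N: "PIdl (pp N) = {\<zero>}"
  unfolding cgenideal_def pp_N by force

lemma card_PIdl_pp_lower: "j \<le> N \<Longrightarrow> q ^ j \<le> card (PIdl (pp (N - j)))"
proof (induction j)
  case (Suc j)
  have "Suc (N - Suc j) = N - j" "pp (N - Suc j) \<noteq> \<zero>" using Suc.prems pp_nonzero by auto
  then have 1: "q * card (PIdl (pp (N - j))) \<le> card (PIdl (pp (N - Suc j)))"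
    using card_PIdl_pp_ge[of "N - Suc j"] by simp
  have 2: "q * q ^ j \<le> q * card (PIdl (pp (N - j)))"
    using Suc by (intro mult_le_mono2) simp
  show ?case unfolding power_Suc by (rule order_trans[OF 2 1])
qed (simp add: PIdl_pp_N)

text \<open>The N - 1 steps below pR contribute a factor of at least q each, so pR has at least
  q^(N-1) elements. The bound on R says that m has at most that many, and pR \<subseteq> m.\<close>

lemma m_eq_PIdl_iff_card: "m = PIdl p1 \<longleftrightarrow> card (carrier R) \<le> q ^ N"
proof
  assume m: "m = PIdl p1"
  have "j \<le> N \<Longrightarrow> card (PIdl (pp (N - j))) = q ^ j" for j
  proof (induction j)
    case (Suc j)
    have "Suc (N - Suc j) = N - j" "pp (N - Suc j) \<noteq> \<zero>" using Suc.prems pp_nonzero by auto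
    then show ?case using card_PIdl_pp_eq[of "N - Suc j", OF _ m] Suc by simp
  qed (simp add: PIdl_pp_N)
  from this[of N] show "card (carrier R) \<le> q ^ N" using PIdl_pp_0 by simp
next
  assume le: "card (carrier R) \<le> q ^ N"
  have "q * card m \<le> q * q ^ (N - 1)"
    using le N_pos unfolding card_carrier by (simp add: power_eq_if)
  also have "\<dots> \<le> q * card (PIdl (pp 1))"
    using card_PIdl_pp_lower[of "N - 1"] N_pos by simp
  finally have "card m \<le> card (PIdl p1)" using q_pos by simp
  moreover have "PIdl p1 \<subseteq> m" by (rule cgenideal_minimal[OF m.ideal_axioms p1_in_m])
  ultimately show "m = PIdl p1" using card_seteq[OF finite_m] by metis
qed

lemma pN_gt_1: "int (p ^ N) > 1"
  using one_less_power[OF p_gt_1 N_pos] of_nat_less_iff[of 1 "p ^ N", where 'a = int]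
  by (simp only: of_nat_1)

lemma iso_galois_ring_card:
  assumes "iso_galois_ring R p N n"
  shows "card (carrier R) \<le> q ^ N"
proof -
  obtain f where f: "galois_modulus p N n f" "R \<simeq> galois_ring p N f"
    using assms unfolding iso_galois_ring_def by blast
  let ?A = "residue_ring (int (p ^ N))"
  have F: "f \<in> carrier (poly_ring ?A)" "lead_coeff f = 1" "degree f = n"
    using f(1) unfolding galois_modulus_def Let_def univ_poly_carrier by auto
  have "f \<noteq> []" using F(3) n_pos by auto
  then have le: "card (carrier (galois_ring p N f)) \<le> nat (int (p ^ N)) ^ degree f"
    unfolding galois_ring_def Let_def using card_quot_monic_le[OF pN_gt_1 F(1) _ F(2)] by simp
  have "nat (int (p ^ N)) ^ degree f = q ^ N"
    unfolding F(3) q_eq nat_int by (simp only: power_mult[symmetric] mult.commute)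
  moreover obtain h where "bij_betw h (carrier R) (carrier (galois_ring p N f))"
    using f(2) unfolding is_ring_iso_def ring_iso_def by blast
  ultimately show ?thesis using le bij_betw_same_card by metis
qed

section \<open>Presentation of R as a Galois ring when m = pR\<close>

lemma exists_generator:
  "\<exists>a\<in>carrier R. \<forall>y\<in>carrier (R Quot m). y = \<zero>\<^bsub>R Quot m\<^esub> \<or> (\<exists>i::nat. y = (m +> a) [^]\<^bsub>R Quot m\<^esub> i)"
proof -
  obtain b where b: "b \<in> carrier (Multiplicative_Group.mult_of (R Quot m))"
    "carrier (Multiplicative_Group.mult_of (R Quot m)) = {b [^]\<^bsub>R Quot m\<^esub> i | i::nat. i \<in> UNIV}"
    using k.finite_field_mult_group_has_gen[OF finite_k] by blast
  obtain a where a: "a \<in> carrier R" "b = m +> a" using b(1) carrier_FactRing by auto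
  have "\<forall>y\<in>carrier (R Quot m). y = \<zero>\<^bsub>R Quot m\<^esub> \<or> (\<exists>i::nat. y = (m +> a) [^]\<^bsub>R Quot m\<^esub> i)"
    using b(2) a(2) by auto
  then show ?thesis using a(1) by blast
qed

context
  fixes a and M :: int
  assumes M: "M = int (p ^ N)" and a: "a \<in> carrier R"
    and gen: "\<And>y. y \<in> carrier (R Quot m) \<Longrightarrow> y = \<zero>\<^bsub>R Quot m\<^esub> \<or> (\<exists>i::nat. y = (m +> a) [^]\<^bsub>R Quot m\<^esub> i)"
    and m_eq: "m = PIdl p1"
begin

abbreviation "Zp \<equiv> residue_ring (int p)"
abbreviation "ZpN \<equiv> residue_ring M"
abbreviation "ev \<equiv> int_eval R a"
abbreviation "evk \<equiv> int_eval (R Quot m) (m +> a)"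

lemma M_gt_1: "M > 1" unfolding M by (rule pN_gt_1)

interpretation B: residues_prime p Zp
  by unfold_locales (rule prime_p)

interpretation A: residues M ZpN
  by unfold_locales (rule M_gt_1)

lemma p_int_gt_1: "int p > 1" using p_gt_1 by simp

interpretation BX: domain "poly_ring Zp"
  by (rule B.univ_poly_is_domain[OF B.carrier_is_subring])

interpretation AX: cring "poly_ring ZpN"
  by (rule poly_ring_residue_cring[OF M_gt_1])

lemma a_bar: "m +> a \<in> carrier (R Quot m)"
  using \<pi>.hom_closed[OF a] .

lemma p_int_k: "add_pow (R Quot m) (int p) \<one>\<^bsub>R Quot m\<^esub> = \<zero>\<^bsub>R Quot m\<^esub>"
  using k.char_of_card[OF prime_p q_eq n_pos] by (simp add: add_pow_int_ge)

lemma M_int_R: "add_pow R M \<one> = \<zero>"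
  unfolding M using pp_N by (simp only: add_pow_int_ge[OF of_nat_0_le_iff] nat_int)

interpretation \<psi>: ring_hom_ring "poly_ring Zp" "R Quot m" evk
  by (rule int_eval_hom_ring[OF p_int_gt_1 k.is_cring a_bar p_int_k])

interpretation \<phi>: ring_hom_ring "poly_ring ZpN" R ev
  by (rule int_eval_hom_ring[OF M_gt_1 is_cring a M_int_R])

lemma coset_ev: "m +> ev g = evk g"
  by (rule \<pi>.hom_int_eval[OF a])

text \<open>Bounds the degree of any relation of the generator from below by counting. Each nonzero
  element of R/m is the value of some x^i, and division by g replaces x^i by a remainder of length
  at most \<open>degree g\<close>; hence p^n \<le> p^(degree g).\<close>

lemma evk_eq_zero_length:
  assumes g: "g \<in> carrier (poly_ring Zp)" "g \<noteq> []" "evk g = \<zero>\<^bsub>R Quot m\<^esub>"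
  shows "length g > n"
proof -
  let ?D = "{r \<in> carrier (poly_ring Zp). length r \<le> degree g}"
  have "carrier (R Quot m) \<subseteq> evk ` ?D"
  proof
    fix y assume y: "y \<in> carrier (R Quot m)"
    show "y \<in> evk ` ?D"
    proof (cases "y = \<zero>\<^bsub>R Quot m\<^esub>")
      case True
      have "[] \<in> ?D" by (simp add: univ_poly_zero_closed)
      moreover have "evk [] = y" unfolding True by (rule k.int_eval_Nil)
      ultimately show ?thesis by (metis (no_types, lifting) image_eqI)
    next
      case False
      then obtain i :: nat where i: "y = (m +> a) [^]\<^bsub>R Quot m\<^esub> i" using gen[OF y] by blast
      \<comment> \<open>This list is the variable x, with the leading coefficient first.\<close>
      let ?X = "[1, 0] :: int list"
      have Xc: "?X \<in> carrier (poly_ring Zp)"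
        using p_gt_1 unfolding univ_poly_carrier[symmetric] polynomial_def
        by (simp add: B.res_carrier_eq B.res_zero_eq)
      have Xe: "evk ?X = m +> a"
        using a_bar by (simp add: k.int_eval_Cons k.int_eval_Nil add_pow_int_ge)
      define P where "P = ?X [^]\<^bsub>poly_ring Zp\<^esub> i"
      have P: "P \<in> carrier (poly_ring Zp)" unfolding P_def using Xc by (rule BX.nat_pow_closed)
      have Pe: "evk P = y" unfolding P_def \<psi>.hom_nat_pow[OF Xc] Xe i ..
      have g0: "g \<noteq> \<zero>\<^bsub>poly_ring Zp\<^esub>" using g(2) by (simp add: univ_poly_zero)
      obtain h r where hr: "h \<in> carrier (poly_ring Zp)" "r \<in> carrier (poly_ring Zp)"
        "P = (g \<otimes>\<^bsub>poly_ring Zp\<^esub> h) \<oplus>\<^bsub>poly_ring Zp\<^esub> r" "r = \<zero>\<^bsub>poly_ring Zp\<^esub> \<or> degree r < degree g"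
        using B.field_long_division_theorem_shell[OF B.carrier_is_subfield P g(1) g0] by blast
      have "y = evk g \<otimes>\<^bsub>R Quot m\<^esub> evk h \<oplus>\<^bsub>R Quot m\<^esub> evk r"
        unfolding Pe[symmetric] hr(3) using g(1) hr(1,2) by simp
      then have "y = evk r" using g(3) hr(1,2) by simp
      moreover have "length r \<le> degree g" using hr(4) by (auto simp: univ_poly_zero)
      ultimately show ?thesis using hr(2) by blast
    qed
  qed
  then have "q \<le> card ?D" using surj_card_le[OF card_bounded_polys(1)[OF p_int_gt_1]] by blast
  then have "p ^ n \<le> p ^ degree g" using card_bounded_polys(2)[OF p_int_gt_1, of "degree g"] q_eq by simp
  then have "n \<le> degree g" using p_gt_1 by simp
  then show ?thesis using g(2) by (cases g) auto
qed

text \<open>Two polynomials of length at most n with equal values differ by one of length at most n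
  with value zero, which must be zero. So evaluation is injective on p^n = q polynomials and fills
  the residue field.\<close>

lemma evk_surj:
  assumes "y \<in> carrier (R Quot m)"
  obtains r where "r \<in> carrier (poly_ring Zp)" "length r \<le> n" "evk r = y"
proof -
  let ?D = "{r \<in> carrier (poly_ring Zp). length r \<le> n}"
  have "inj_on evk ?D"
  proof (rule inj_onI)
    fix r s assume rs: "r \<in> ?D" "s \<in> ?D" "evk r = evk s"
    let ?t = "r \<ominus>\<^bsub>poly_ring Zp\<^esub> s"
    have c: "r \<in> carrier (poly_ring Zp)" "s \<in> carrier (poly_ring Zp)" using rs by auto
    have t: "?t \<in> carrier (poly_ring Zp)" using c by (rule BX.minus_closed)
    have "length (\<ominus>\<^bsub>poly_ring Zp\<^esub> s) = length s"
      by (rule B.univ_poly_a_inv_length[OF B.carrier_is_subring c(2)])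
    then have "max (length r) (length (\<ominus>\<^bsub>poly_ring Zp\<^esub> s)) \<le> n" using rs by simp
    then have "length ?t \<le> n"
      unfolding a_minus_def univ_poly_add by (rule order_trans[OF B.poly_add_length_le])
    moreover have "evk ?t = \<zero>\<^bsub>R Quot m\<^esub>"
      using c rs(3) by (simp add: a_minus_def k.r_neg)
    ultimately have "?t = []" using evk_eq_zero_length[OF t] by fastforce
    then have "?t = \<zero>\<^bsub>poly_ring Zp\<^esub>" by (simp add: univ_poly_zero)
    then show "r = s" using c BX.r_right_minus_eq by simp
  qed
  then have "card (evk ` ?D) = q"
    using card_bounded_polys(2)[OF p_int_gt_1, of n] by (simp add: card_image q_eq)
  moreover have "evk ` ?D \<subseteq> carrier (R Quot m)" by auto
  ultimately have "evk ` ?D = carrier (R Quot m)" using card_subset_eq[OF finite_k] by simp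
  then have "y \<in> evk ` ?D" using assms by simp
  then obtain r where "y = evk r" "r \<in> ?D" by (rule imageE)
  then show ?thesis by (intro that) auto
qed

abbreviation "short \<equiv> {r \<in> carrier (poly_ring ZpN). length r \<le> n}"

lemma ev_short_add:
  assumes "x \<in> ev ` short" "y \<in> ev ` short"
  shows "x \<oplus> y \<in> ev ` short"
proof -
  obtain r s where rs: "r \<in> short" "s \<in> short" "x = ev r" "y = ev s" using assms by blast
  then have "x \<oplus> y = ev (r \<oplus>\<^bsub>poly_ring ZpN\<^esub> s)" by simp
  moreover have "max (length r) (length s) \<le> n" using rs(1,2) by simp
  then have "length (r \<oplus>\<^bsub>poly_ring ZpN\<^esub> s) \<le> n"
    unfolding univ_poly_add by (rule order_trans[OF A.poly_add_length_le])
  then have "r \<oplus>\<^bsub>poly_ring ZpN\<^esub> s \<in> short" using rs(1,2) by simp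
  ultimately show ?thesis by blast
qed

lemma ev_short_add_pow:
  assumes "x \<in> ev ` short"
  shows "add_pow R (k::nat) x \<in> ev ` short"
proof (induction k)
  case 0
  have "[] \<in> short" by (simp add: univ_poly_zero_closed)
  moreover have "ev [] = \<zero>" by (rule int_eval_Nil)
  ultimately show ?case by (metis (no_types, lifting) add.nat_pow_0 image_eqI)
next
  case (Suc k)
  then show ?case using ev_short_add assms by simp
qed

text \<open>p-adic approximation: the class of y modulo m = pR is the value of a short r, so y = ev
  r + p z and p^j y = p^j (ev r) + p^(j+1) z. The first term is an integer multiple of
  \<open>ev r\<close>, hence again a value on \<open>short\<close>. At j = N the error
  vanishes.\<close>

lemma ev_short_approx: "\<forall>x\<in>carrier R. \<exists>w\<in>ev ` short. \<exists>y\<in>carrier R. x = w \<oplus> pp j \<otimes> y"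
proof (induction j)
  case 0
  show ?case
  proof
    fix x assume x: "x \<in> carrier R"
    have "[] \<in> short" by (simp add: univ_poly_zero_closed)
    moreover have "x = ev [] \<oplus> pp 0 \<otimes> x" using x by (simp add: int_eval_Nil)
    ultimately show "\<exists>w\<in>ev ` short. \<exists>y\<in>carrier R. x = w \<oplus> pp 0 \<otimes> y" using x by blast
  qed
next
  case (Suc j)
  show ?case
  proof
    fix x assume x: "x \<in> carrier R"
    obtain w y where wy: "w \<in> ev ` short" "y \<in> carrier R" "x = w \<oplus> pp j \<otimes> y" using Suc x by blast
    obtain r where r: "r \<in> carrier (poly_ring Zp)" "length r \<le> n" "evk r = m +> y"
      using evk_surj[of "m +> y"] \<pi>.hom_closed[OF wy(2)] by blast
    \<comment> \<open>The residues 0..p - 1 are also residues modulo p^N, so the list r itself is a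
      polynomial over Z/p^N and needs no lifting.\<close>
    have "p \<le> p ^ N" using p_gt_1 N_pos self_le_power[of p N] by simp
    then have "int p \<le> M" unfolding M by (simp only: of_nat_le_iff)
    then have "carrier Zp \<subseteq> carrier ZpN" unfolding B.res_carrier_eq A.res_carrier_eq by auto
    then have "r \<in> carrier (poly_ring ZpN)"
      using r(1) unfolding univ_poly_carrier[symmetric] polynomial_def
      by (auto simp: A.res_zero_eq B.res_zero_eq)
    then have rs: "r \<in> short" using r(2) by simp
    have rc: "ev r \<in> carrier R" by (rule int_eval_in_carrier[OF a])
    have "m +> y = m +> ev r" using r(3) coset_ev by simp
    then have "y \<ominus> ev r \<in> PIdl p1"
      using quotient_eq_iff_same_a_r_cos[OF m.ideal_axioms wy(2) rc] m_eq by simp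
    then obtain z where z: "z \<in> carrier R" "y \<ominus> ev r = z \<otimes> p1" unfolding cgenideal_def by blast
    have y: "y = z \<otimes> p1 \<oplus> ev r" using minus_cancel(4)[OF rc wy(2)] z(2) by simp
    have "pp j \<otimes> y = add_pow R (p ^ j) (ev r) \<oplus> pp (Suc j) \<otimes> z"
    proof -
      have "pp j \<otimes> ev r = add_pow R (p ^ j) (ev r)" using add_pow_ldistr[of \<one> "ev r"] rc by simp
      moreover have "pp j \<otimes> (z \<otimes> p1) = pp (Suc j) \<otimes> z"
        unfolding pp_Suc using z(1) by (simp add: m_ac)
      ultimately show ?thesis unfolding y using z(1) rc by (simp add: r_distr a_comm)
    qed
    moreover have ws: "add_pow R (p ^ j) (ev r) \<in> ev ` short" by (rule ev_short_add_pow) (use rs in blast)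
    moreover have wc: "w \<in> carrier R" using wy(1) int_eval_in_carrier[OF a] by auto
    ultimately have "x = (w \<oplus> add_pow R (p ^ j) (ev r)) \<oplus> pp (Suc j) \<otimes> z"
      unfolding wy(3) using z(1) rc by (simp add: a_assoc)
    then show "\<exists>w\<in>ev ` short. \<exists>y\<in>carrier R. x = w \<oplus> pp (Suc j) \<otimes> y"
      using ev_short_add[OF wy(1) ws] z(1) by blast
  qed
qed

lemma ev_short_image: "ev ` short = carrier R"
proof
  show "ev ` short \<subseteq> carrier R" using int_eval_in_carrier[OF a] by blast
  show "carrier R \<subseteq> ev ` short"
  proof
    fix x assume x: "x \<in> carrier R"
    then obtain w y where "w \<in> ev ` short" "y \<in> carrier R" "x = w \<oplus> pp N \<otimes> y"
      using ev_short_approx[of N] by blast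
    moreover from this have "w \<in> carrier R" using int_eval_in_carrier[OF a] by blast
    ultimately show "x \<in> ev ` short" using pp_N by simp
  qed
qed

text \<open>\<open>short\<close> has (p^N)^n = q^N elements and evaluation maps it onto R, which by
  the chain p^i R has at least as many.\<close>

lemma inj_on_ev_short: "inj_on ev short"
proof (rule eq_card_imp_inj_on)
  show "finite short" by (rule card_bounded_polys(1)[OF M_gt_1])
  have "card short = q ^ N"
    using card_bounded_polys(2)[OF M_gt_1, of n] unfolding q_eq M nat_int
    by (simp only: power_mult[symmetric] mult.commute)
  moreover have "card (ev ` short) \<le> card short"
    using card_image_le card_bounded_polys(1)[OF M_gt_1] by blast
  moreover have "q ^ N \<le> card (carrier R)" using card_PIdl_pp_lower[of N] PIdl_pp_0 by simp
  ultimately show "card (ev ` short) = card short" unfolding ev_short_image by simp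
qed

lemma exists_monic_relation:
  obtains f where "f \<in> carrier (poly_ring ZpN)" "length f = Suc n" "lead_coeff f = 1" "ev f = \<zero>"
proof -
  obtain r where r: "r \<in> short" "a [^] n = ev r"
    using ev_short_image nat_pow_closed[OF a, of n] by (metis (no_types, lifting) imageE)
  define t where "t = map (\<lambda>c. c mod M) (map uminus r)"
  \<comment> \<open>f is x^n - r: the zeros pad -r to length n, so that the leading 1 sits in degree
    exactly n.\<close>
  define f where "f = 1 # replicate (n - length r) 0 @ t"
  have t: "set t \<subseteq> carrier ZpN" unfolding t_def using set_map_mod[OF M_gt_1] by blast
  have "0 \<in> carrier ZpN" "1 \<in> carrier ZpN" using M_gt_1 unfolding A.res_carrier_eq by auto
  then have "set f \<subseteq> carrier ZpN" unfolding f_def using t by auto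
  then have "f \<in> carrier (poly_ring ZpN)"
    unfolding univ_poly_carrier[symmetric] polynomial_def f_def by (simp add: A.res_zero_eq)
  moreover have len: "length (replicate (n - length r) 0 @ t) = n" using r(1) unfolding t_def by simp
  then have "length f = Suc n" unfolding f_def by simp
  moreover have "lead_coeff f = 1" unfolding f_def by simp
  moreover have "ev f = \<zero>"
  proof -
    have "ev t = ev (map uminus r)"
      unfolding t_def int_eval_def map_map comp_def
      using add_pow_mod[OF M_gt_1 is_cring a M_int_R] by simp
    also have "\<dots> = \<ominus> (a [^] n)" unfolding r(2) by (rule int_eval_uminus[OF a])
    finally have "ev (replicate (n - length r) 0 @ t) = \<ominus> (a [^] n)" using int_eval_zeros[OF a] by simp
    then have "ev f = add_pow R (1::int) \<one> \<otimes> a [^] n \<oplus> \<ominus> (a [^] n)"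
      unfolding f_def int_eval_Cons len by simp
    then show ?thesis using a by (simp add: add_pow_int_ge r_neg)
  qed
  ultimately show ?thesis by (rule that)
qed

text \<open>The residue field has no zero divisors, so one factor vanishes at the generator and has
  degree at least n. The degrees add up to n, which makes the other factor a nonzero constant, hence
  a unit.\<close>

lemma pirreducible_relation:
  assumes f: "length f = Suc n" "lead_coeff f = 1" "ev f = \<zero>"
  shows "pirreducible\<^bsub>Zp\<^esub> (carrier Zp) (map (\<lambda>c. c mod int p) f)"
proof -
  let ?fb = "map (\<lambda>c. c mod int p) f"
  have hd: "lead_coeff ?fb = 1" using f(1,2) p_gt_1 by (cases f) auto
  have nn: "?fb \<noteq> []" using f(1) by auto
  have "set ?fb \<subseteq> carrier Zp" by (rule set_map_mod[OF p_int_gt_1])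
  then have poly: "polynomial\<^bsub>Zp\<^esub> (carrier Zp) ?fb"
    unfolding polynomial_def hd by (simp add: B.res_zero_eq)
  then have fb: "?fb \<in> carrier (poly_ring Zp)" unfolding univ_poly_carrier .
  have "red_poly (int p) f = ?fb" unfolding red_poly_def by (rule B.normalize_polynomial[OF poly])
  then have "evk ?fb = evk f" using int_eval_red_poly[OF p_int_gt_1 k.is_cring a_bar p_int_k] by metis
  also have "\<dots> = \<zero>\<^bsub>R Quot m\<^esub>" unfolding coset_ev[symmetric] f(3) by simp
  finally have fb0: "evk ?fb = \<zero>\<^bsub>R Quot m\<^esub>" .
  have deg: "degree ?fb = n" using f(1) by simp
  have units: "u \<in> Units (poly_ring Zp) \<longleftrightarrow> u \<in> carrier (poly_ring Zp) \<and> u \<noteq> [] \<and> degree u = 0" for u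
    by (rule B.univ_poly_units'[OF B.carrier_is_subfield])
  show ?thesis
  proof (rule B.pirreducibleI[OF B.carrier_is_subring fb nn])
    show "?fb \<notin> Units (poly_ring Zp)" unfolding units deg using n_pos by simp
    fix g h assume g: "g \<in> carrier (poly_ring Zp)" and h: "h \<in> carrier (poly_ring Zp)"
      and gh: "?fb = g \<otimes>\<^bsub>poly_ring Zp\<^esub> h"
    have ne: "g \<noteq> []" "h \<noteq> []"
    proof -
      show "g \<noteq> []" using gh nn BX.l_null[OF h] by (auto simp: univ_poly_zero)
      show "h \<noteq> []" using gh nn BX.r_null[OF g] by (auto simp: univ_poly_zero)
    qed
    have d: "degree g + degree h = n"
      using B.poly_mult_degree_eq[OF B.carrier_is_subring, of g h] g h ne deg gh
      unfolding univ_poly_carrier univ_poly_mult by simp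
    have "evk g \<otimes>\<^bsub>R Quot m\<^esub> evk h = \<zero>\<^bsub>R Quot m\<^esub>" using fb0 unfolding gh \<psi>.hom_mult[OF g h] .
    then consider "evk g = \<zero>\<^bsub>R Quot m\<^esub>" | "evk h = \<zero>\<^bsub>R Quot m\<^esub>"
      using k.integral \<psi>.hom_closed[OF g] \<psi>.hom_closed[OF h] by blast
    then show "g \<in> Units (poly_ring Zp) \<or> h \<in> Units (poly_ring Zp)"
    proof cases
      case 1
      then have "degree h = 0" using evk_eq_zero_length[OF g ne(1)] d by linarith
      then show ?thesis using units h ne by blast
    next
      case 2
      then have "degree g = 0" using evk_eq_zero_length[OF h ne(2)] d by linarith
      then show ?thesis using units g ne by blast
    qed
  qed
qed

text \<open>The kernel of evaluation is generated by f: the remainder of a kernel element on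
  division by f is short and evaluates to zero, so it is zero by injectivity on
  \<open>short\<close>.\<close>

lemma iso_galois_ring_of_generator: "iso_galois_ring R p N n"
proof -
  obtain f where f: "f \<in> carrier (poly_ring ZpN)" "length f = Suc n" "lead_coeff f = 1" "ev f = \<zero>"
    by (rule exists_monic_relation)
  have fn: "f \<noteq> []" using f(2) by auto
  have mod: "galois_modulus p N n f"
    unfolding galois_modulus_def Let_def univ_poly_carrier M[symmetric]
    using f pirreducible_relation[OF f(2,3,4)] by simp
  have "a_kernel (poly_ring ZpN) R ev = PIdl\<^bsub>poly_ring ZpN\<^esub> f"
  proof
    have fk: "f \<in> a_kernel (poly_ring ZpN) R ev" unfolding a_kernel_def' using f(1,4) by blast
    then show "PIdl\<^bsub>poly_ring ZpN\<^esub> f \<subseteq> a_kernel (poly_ring ZpN) R ev"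
      by (rule AX.cgenideal_minimal[OF \<phi>.kernel_is_ideal])
    show "a_kernel (poly_ring ZpN) R ev \<subseteq> PIdl\<^bsub>poly_ring ZpN\<^esub> f"
    proof
      fix g assume "g \<in> a_kernel (poly_ring ZpN) R ev"
      then have g: "g \<in> carrier (poly_ring ZpN)" "ev g = \<zero>" unfolding a_kernel_def' by blast+
      obtain h r where hr: "h \<in> carrier (poly_ring ZpN)" "r \<in> carrier (poly_ring ZpN)"
        "g = (f \<otimes>\<^bsub>poly_ring ZpN\<^esub> h) \<oplus>\<^bsub>poly_ring ZpN\<^esub> r" "length r < length f"
        using monic_division[OF M_gt_1 f(1) fn f(3) g(1)] by blast
      have "ev g = ev f \<otimes> ev h \<oplus> ev r" unfolding hr(3) using f(1) hr(1,2) by simp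
      then have "ev r = ev []" using g(2) f(4) hr(1,2) by (simp add: int_eval_Nil)
      moreover have "r \<in> short" "[] \<in> short" using hr(2,4) f(2) by (auto simp: univ_poly_zero_closed)
      ultimately have "r = []" using inj_on_ev_short unfolding inj_on_def by blast
      then have "r = \<zero>\<^bsub>poly_ring ZpN\<^esub>" by (simp add: univ_poly_zero)
      then have "g = h \<otimes>\<^bsub>poly_ring ZpN\<^esub> f"
        unfolding hr(3) using f(1) hr(1) by (simp add: AX.m_comm)
      then show "g \<in> PIdl\<^bsub>poly_ring ZpN\<^esub> f" unfolding cgenideal_def using hr(1) by blast
    qed
  qed
  moreover have "ev ` carrier (poly_ring ZpN) = carrier R"
  proof
    show "ev ` carrier (poly_ring ZpN) \<subseteq> carrier R" by auto
    show "carrier R \<subseteq> ev ` carrier (poly_ring ZpN)" unfolding ev_short_image[symmetric] by blast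
  qed
  ultimately have "galois_ring p N f \<simeq> R"
    using \<phi>.FactRing_iso unfolding galois_ring_def Let_def M[symmetric] by simp
  moreover have "ring (galois_ring p N f)"
    unfolding galois_ring_def Let_def M[symmetric]
    by (rule ideal.quotient_is_ring[OF AX.cgenideal_ideal[OF f(1)]])
  ultimately have "R \<simeq> galois_ring p N f" using ring_iso_sym by blast
  then show ?thesis unfolding iso_galois_ring_def using mod by blast
qed

end

lemma iso_galois_ring_iff: "iso_galois_ring R p N n \<longleftrightarrow> base = m"
proof
  assume "iso_galois_ring R p N n"
  then show "base = m"
    using iso_galois_ring_card m_eq_PIdl_iff_card base_eq_m_iff by blast
next
  assume "base = m"
  then have m: "m = PIdl p1" using base_eq_m_iff by blast
  obtain a where "a \<in> carrier R"
    "\<And>y. y \<in> carrier (R Quot m) \<Longrightarrow> y = \<zero>\<^bsub>R Quot m\<^esub> \<or> (\<exists>i::nat. y = (m +> a) [^]\<^bsub>R Quot m\<^esub> i)"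
    using exists_generator by blast
  then show "iso_galois_ring R p N n" using iso_galois_ring_of_generator[OF refl _ _ m] by blast
qed

end

end

theorem mainTheorem20:
  fixes R :: "('a, 'b) ring_scheme" and m :: "'a set"
    and p N n q \<rho> :: nat
  assumes "cring R" and "finite (carrier R)"
    and "maximalideal m R"
    and "\<And>I. maximalideal I R \<Longrightarrow> I = m"
    and "Factorial_Ring.prime p"
    and "ring_char R = p ^ N"
    and "q = p ^ n" and "n > 1"
    and "card (carrier (R Quot m)) = q"
    and "card ((\<lambda>x. (m \<cdot>\<^bsub>R\<^esub> m <+>\<^bsub>R\<^esub> {([p] \<cdot>\<^bsub>R\<^esub> \<one>\<^bsub>R\<^esub>) \<otimes>\<^bsub>R\<^esub> y | y. y \<in> carrier R}) +>\<^bsub>R\<^esub> x) ` m)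
           = q ^ \<rho>"
  shows
    "(\<forall>S. max_subring R S \<longrightarrow>
        (res_field R m S = carrier (R Quot m) \<and> \<not> max_subfield (R Quot m) (res_field R m S)) \<or>
        (max_subfield (R Quot m) (res_field R m S) \<and> res_field R m S \<noteq> carrier (R Quot m)))
   \<and> card {S. max_subring R S \<and> res_field R m S = carrier (R Quot m)} = (q ^ \<rho> - 1) div (q - 1)
   \<and> (card {S. max_subring R S \<and> res_field R m S = carrier (R Quot m)} = 0
        \<longleftrightarrow> iso_galois_ring R p N n)
   \<and> (\<forall>S. max_subring R S \<and> res_field R m S = carrier (R Quot m) \<longrightarrow> add_index R S = q)
   \<and> (\<forall>F. max_subfield (R Quot m) F \<longrightarrow>
        {S. max_subring R S \<and> res_field R m S = F} = {{x \<in> carrier R. proj R m x \<in> F}}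
        \<and> add_index R {x \<in> carrier R. proj R m x \<in> F} = add_index (R Quot m) F)
   \<and> card {S. max_subring R S \<and> max_subfield (R Quot m) (res_field R m S)} = card (prime_factors n)"
proof -
  interpret cring R by (rule assms(1))
  interpret L: local_ring_prime R m p n
  proof (intro local_ring_prime.intro finite_local_ring.intro finite_local_ring_axioms.intro
      local_ring_prime_axioms.intro)
    show "card (carrier (R Quot m)) = p ^ n" using assms(7,9) by (rule trans[rotated])
    show "n > 0" using assms(8) by (rule less_trans[rotated]) simp
  qed (rule assms, assumption?)+
  have q: "card (carrier (R Quot m)) = q" by (rule assms(9))
  let ?U = "{S. max_subring R S \<and> res_field R m S = carrier (R Quot m)}"
  have U: "?U = L.unramified_max_subrings" unfolding L.unramified_max_subrings_def ..
  \<comment> \<open>The hypothesis counts the cosets of J meeting m; since J \<subseteq> m this is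
    the index of J in m.\<close>
  have "card (a_r_coset R L.base ` m) = q ^ \<rho>"
    using assms(10) unfolding L.base_def .
  moreover have "L.base \<inter> m = L.base" using L.base_subset_m by blast
  ultimately have cm: "card m = q ^ \<rho> * card L.base"
    using card_image_cosets_restrict[OF additive_subgroup_ideal[OF L.ideal_base]
        additive_subgroup_ideal[OF L.m.ideal_axioms] assms(2)] by simp
  then have cardU: "card ?U = (q ^ \<rho> - 1) div (q - 1)"
    using L.card_unramified_max_subrings[of \<rho>] unfolding U q by simp
  have q1: "q > 1" using L.q_gt_1 unfolding q .
  have base_iff: "\<rho> = 0 \<longleftrightarrow> L.base = m"
  proof
    assume "\<rho> = 0"
    then show "L.base = m" using cm L.base_subset_m L.finite_m by (simp add: card_subset_eq)
  next
    assume "L.base = m"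
    then have "q ^ \<rho> = 1" using cm L.card_m_nonzero by simp
    then show "\<rho> = 0" using q1 by simp
  qed
  \<comment> \<open>Integer division yields 0 only if the numerator is below q - 1, that is,
    q^\<rho> < q.\<close>
  have U0: "card ?U = 0 \<longleftrightarrow> \<rho> = 0"
  proof
    assume "card ?U = 0"
    then have "q ^ \<rho> - 1 < q - 1" unfolding cardU using q1 by (simp add: div_eq_0_iff)
    then have "q ^ \<rho> < q ^ 1" by simp
    then show "\<rho> = 0" using power_less_imp_less_exp[OF q1] by blast
  qed (simp add: cardU)
  \<comment> \<open>\<open>ring_char\<close> defaults to 0, which is not a power of p, so the least
    positive multiple annihilating the unit exists and equals p^N.\<close>
  have ex: "\<exists>k::nat. 0 < k \<and> [k] \<cdot>\<^bsub>R\<^esub> \<one>\<^bsub>R\<^esub> = \<zero>\<^bsub>R\<^esub>"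
    using assms(6) L.p_gt_1 unfolding ring_char_def by (auto split: if_splits)
  then have least: "(LEAST k::nat. 0 < k \<and> [k] \<cdot>\<^bsub>R\<^esub> \<one>\<^bsub>R\<^esub> = \<zero>\<^bsub>R\<^esub>) = p ^ N"
    using assms(6) unfolding ring_char_def by simp
  have ppN: "L.pp N = \<zero>\<^bsub>R\<^esub>"
    using LeastI_ex[OF ex] unfolding least by simp
  have pp_nz: "L.pp i \<noteq> \<zero>\<^bsub>R\<^esub>" if "i < N" for i
  proof
    assume "L.pp i = \<zero>\<^bsub>R\<^esub>"
    moreover have "0 < p ^ i" "p ^ i < p ^ N" using L.p_gt_1 that by simp_all
    ultimately show False
      using not_less_Least[of "p ^ i" "\<lambda>k. 0 < k \<and> [k] \<cdot>\<^bsub>R\<^esub> \<one>\<^bsub>R\<^esub> = \<zero>\<^bsub>R\<^esub>"] unfolding least by blast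
  qed
  have iso: "card ?U = 0 \<longleftrightarrow> iso_galois_ring R p N n"
    unfolding U0 base_iff using L.iso_galois_ring_iff[OF ppN pp_nz] by simp
  show ?thesis
  proof (intro conjI allI impI)
    fix S assume S: "max_subring R S"
    have nmax: "\<not> max_subfield (R Quot m) (carrier (R Quot m))" unfolding max_subfield_def by simp
    show "(res_field R m S = carrier (R Quot m) \<and> \<not> max_subfield (R Quot m) (res_field R m S)) \<or>
        (max_subfield (R Quot m) (res_field R m S) \<and> res_field R m S \<noteq> carrier (R Quot m))"
    proof (cases "res_field R m S = carrier (R Quot m)")
      case True
      then show ?thesis using nmax by simp
    next
      case False
      then show ?thesis using L.max_subring_res_field(1)[OF S] by simp
    qed
  next
    show "card ?U = (q ^ \<rho> - 1) div (q - 1)" by (rule cardU)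
  next
    show "card ?U = 0 \<longleftrightarrow> iso_galois_ring R p N n" by (rule iso)
  next
    fix S assume "max_subring R S \<and> res_field R m S = carrier (R Quot m)"
    then have "S \<in> L.unramified_max_subrings" unfolding U[symmetric] by simp
    from L.index_unramified_max_subring[OF this] show "add_index R S = q" unfolding q .
  next
    fix F assume F: "max_subfield (R Quot m) F"
    show "{S. max_subring R S \<and> res_field R m S = F} = {{x \<in> carrier R. proj R m x \<in> F}}"
      by (rule L.max_subrings_over_max_subfield[OF F])
    have "subfield F (R Quot m)" using F unfolding max_subfield_def by simp
    then show "add_index R {x \<in> carrier R. proj R m x \<in> F} = add_index (R Quot m) F"
      by (rule L.index_res_pre)
  next
    show "card {S. max_subring R S \<and> max_subfield (R Quot m) (res_field R m S)} = card (prime_factors n)"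
      by (rule L.card_max_subrings_max_subfield)
  qed
qed

end
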